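(* Let $\mathcal{L}$ be a countable first-order language, let $T$ be an $\mathcal{L}$-theory in which each formula is of prenex form, and let $\mathcal{G}$ be a prenex $\mathcal{L}$-hypersequent (each formula occurring in $\mathcal{G}$ is of prenex form). If $T\models_{[0,1]}\mathcal{G}$, then for each positive integer $n$ there exists a propositional $\mathcal{L}$-hypersequent $\mathcal{G}^n$ satisfying the following conditions: (a) $\vdash_{\mathrm{G\text{Ł}}}\mathcal{G}^n$; and (b) there exist positive integers $m_1,\dots,m_k$ and formulas $C_1,\dots,C_k\in T$ (where $k\ge0$; $k=0$ is allowed) such that $$m_1C_1\Rightarrow_{\frac1n}\bot\mid\cdots\mid m_kC_k\Rightarrow_{\frac1n}\bot\mid\mathcal{G}_{\frac1n}$$ is derivable from $\mathcal{G}^n$ by using only the rules $(\forall\Rightarrow_{\frac1n})$, $(\Rightarrow_{\frac1n}\forall)$, $(\exists\Rightarrow_{\frac1n})$, $(\Rightarrow_{\frac1n}\exists)$, (EW) and (EC).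
   Context: **Syntax.** Fix two disjoint infinite sets of variables: free variables ($a,b,c,\dots$) and bound variables ($x,y,z,\dots$). A first-order language $\mathcal{L}$ consists of predicate, function and constant symbols (with arities). $\mathcal{L}$-terms are built from free variables, constants and function symbols; $\mathcal{L}$-semiterms may also use bound variables. $\mathcal{L}$-formulas: $\bot$; atomic formulas $P(t_1,\dots,t_k)$ with $t_i$ $\mathcal{L}$-terms; $A\to B$; and $\forall xA[x/a]$, $\exists xA[x/a]$, where $A$ is an $\mathcal{L}$-formula, $a$ a free variable, $x$ a bound variable not occurring in $A$, and $A[x/a]$ replaces every occurrence of $a$ by $x$. Semiformulas are like formulas except that bound variables may also occur free. For $\forall xA(x)$ or $\exists xA(x)$ and a term $t$, $A(t)$ is the result of replacing the free occurrences of $x$ in $A$ by $t$. A formula is of prenex form if it is a (possibly empty) block of quantifiers followed by a quantifier-free semiformula. A sequent $\Gamma\Rightarrow\Delta$ is an ordered pair of finite multisets of formulas. A hypersequent $\mathcal{S}_1\mid\cdots\mid\mathcal{S}_r$ is a finite multiset of sequents; it is propositional if each formula in it is quantifier-free. An $\mathcal{L}$-theory is a set of $\mathcal{L}$-formulas. Commas and $\mid$ denote multiset union; $nA$ is the multiset of $n$ copies of $A$; $n\Gamma$ is the $n$-fold multiset union of $\Gamma$. **Affine $[0,1]$-semantics ($0$ is truth, $1$ is falsity).** A $[0,1]$-interpretation $\mathfrak{I}=(\mathcal{M},\beta)$ consists of a structure $\mathcal{M}$ with nonempty universe $M$, with the usual interpretations of constants and function symbols, and with $P^{\mathcal{M}}:M^k\to[0,1]$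 for each $k$-ary predicate symbol $P$, together with an assignment $\beta$ of elements of $M$ to all free and bound variables, extended to semiterms as usual. $\mathfrak{I}[x\mapsto m]$ changes the value of $\beta$ at $x$ to $m$. Truth values: $[\![\bot]\!]=1$; $[\![P(t_1,\dots,t_k)]\!]=P^{\mathcal{M}}(\beta(t_1),\dots,\beta(t_k))$; $[\![A\to B]\!]=\max\{[\![B]\!]-[\![A]\!],0\}$; $[\![\forall xA]\!]_{\mathfrak{I}}=\sup_{m\in M}[\![A]\!]_{\mathfrak{I}[x\mapsto m]}$; $[\![\exists xA]\!]_{\mathfrak{I}}=\inf_{m\in M}[\![A]\!]_{\mathfrak{I}[x\mapsto m]}$; $[\![\Gamma]\!]=\sum_{A\in\Gamma}[\![A]\!]$ (with $[\![\varnothing]\!]=0$); $[\![\Gamma\Rightarrow\Delta]\!]=[\![\Delta]\!]-[\![\Gamma]\!]$; $[\![\mathcal{G}]\!]=\inf_{\mathcal{S}\in\mathcal{G}}[\![\mathcal{S}]\!]$. A hypersequent $\mathcal{G}$ is true in $\mathfrak{I}$ if $[\![\mathcal{G}]\!]_{\mathfrak{I}}\le 0$. A formula $A$ is identified with the hypersequent $\Rightarrow A$, so $A$ is true iff $[\![A]\!]_{\mathfrak{I}}=0$. $\mathfrak{I}$ is a $[0,1]$-model of $T$ if every formula of $T$ is true in $\mathfrak{I}$. $T\models_{[0,1]}\mathcal{G}$ means that $\mathcal{G}$ is true in every $[0,1]$-model of $T$. **Approximations.** For a positive integer $n$, $\Gamma\Rightarrow_{\frac1n}\Delta$ denotes the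 sequent $\bot,n\Gamma\Rightarrow n\Delta$. For $\mathcal{G}=\Gamma_1\Rightarrow\Delta_1\mid\cdots\mid\Gamma_r\Rightarrow\Delta_r$, $\mathcal{G}_{\frac1n}$ denotes $\Gamma_1\Rightarrow_{\frac1n}\Delta_1\mid\cdots\mid\Gamma_r\Rightarrow_{\frac1n}\Delta_r$. **Propositional calculus $\mathrm{GŁ}$** (premises / conclusion; $\mathcal{G}$ is an arbitrary, possibly empty, side hypersequent unless stated otherwise; atomic $\mathcal{L}$-formulas play the role of propositional variables). Axioms: $A\Rightarrow A$; $\Rightarrow$ (the empty sequent); $\bot\Rightarrow A$. Rules: (EW) $\mathcal{G}$ / $\mathcal{G}\mid\Gamma\Rightarrow\Delta$, with $\mathcal{G}\ne\varnothing$; (EC) $\mathcal{G}\mid\Gamma\Rightarrow\Delta\mid\Gamma\Rightarrow\Delta$ / $\mathcal{G}\mid\Gamma\Rightarrow\Delta$; (IW) $\mathcal{G}\mid\Gamma\Rightarrow\Delta$ / $\mathcal{G}\mid\Gamma,A\Rightarrow\Delta$; (S) $\mathcal{G}\mid\Gamma_1,\Gamma_2\Rightarrow\Delta_1,\Delta_2$ / $\mathcal{G}\mid\Gamma_1\Rightarrow\Delta_1\mid\Gamma_2\Rightarrow\Delta_2$; (M) $\mathcal{G}\mid\Gamma_1\Rightarrow\Delta_1$ and $\mathcal{G}\mid\Gamma_2\Rightarrow\Delta_2$ / $\mathcal{G}\mid\Gamma_1,\Gamma_2\Rightarrow\Delta_1,\Delta_2$; ($\to\Rightarrow$) $\mathcal{G}\mid\Gamma\Rightarrow\Delta\mid\Gamma,B\Rightarrow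 A,\Delta$ / $\mathcal{G}\mid\Gamma,A\to B\Rightarrow\Delta$; ($\Rightarrow\to$) $\mathcal{G}\mid\Gamma\Rightarrow\Delta$ and $\mathcal{G}\mid\Gamma,A\Rightarrow B,\Delta$ / $\mathcal{G}\mid\Gamma\Rightarrow A\to B,\Delta$. $\vdash_{\mathrm{GŁ}}\mathcal{G}$ means that $\mathcal{G}$ is the root of a finite derivation tree whose leaves are axioms and whose other nodes are obtained by these rules. **Approximate quantifier rules** ($t$ any $\mathcal{L}$-term; $a$ a free variable not occurring in the conclusion): ($\forall\Rightarrow_{\frac1n}$) $\mathcal{G}\mid\Gamma,A(t)\Rightarrow_{\frac1n}\Delta$ / $\mathcal{G}\mid\Gamma,\forall xA(x)\Rightarrow_{\frac1n}\Delta$; ($\Rightarrow_{\frac1n}\forall$) $\mathcal{G}\mid\Gamma\Rightarrow_{\frac1n}A(a),\Delta$ / $\mathcal{G}\mid\Gamma\Rightarrow_{\frac1n}\forall xA(x),\Delta$; ($\exists\Rightarrow_{\frac1n}$) $\mathcal{G}\mid\Gamma,A(a)\Rightarrow_{\frac1n}\Delta$ / $\mathcal{G}\mid\Gamma,\exists xA(x)\Rightarrow_{\frac1n}\Delta$; ($\Rightarrow_{\frac1n}\exists$) $\mathcal{G}\mid\Gamma\Rightarrow_{\frac1n}A(t),\Delta$ / $\mathcal{G}\mid\Gamma\Rightarrow_{\frac1n}\exists xA(x),\Delta$. "Derivable from $\mathcal{G}^n$ by using" certain rules means obtained by finitely many applications of those rules (with $\mathcal{L}$-hypersequents) starting from $\mathcal{G}^n$.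 *)

theory Defs
  imports "HOL-Library.Multiset" "HOL-Library.Countable_Set" "HOL-Library.Extended_Real"
begin

section \<open>Syntax\<close>

text \<open>Constant symbols are the function symbols of arity 0.\<close>

record ('f, 'p) lang =
  funs :: "'f set"
  preds :: "'p set"
  farity :: "'f \<Rightarrow> nat"
  parity :: "'p \<Rightarrow> nat"

definition countable_lang :: "('f, 'p) lang \<Rightarrow> bool" where
  "countable_lang L \<longleftrightarrow> countable (funs L) \<and> countable (preds L)"

text \<open>\<open>Fv\<close>: free variables; \<open>Bv\<close>: bound variables.\<close>

datatype var = Fv nat | Bv nat

text \<open>The two datatypes below contain all raw expressions; terms and formulas over a language
  are singled out by the predicates \<open>lterm\<close> and \<open>formula\<close>.\<close>

datatype 'f tm = Var var | Fn 'f "'f tm list"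

datatype ('f, 'p) fm =
    Bot
  | Pred 'p "'f tm list"
  | Imp "('f, 'p) fm" "('f, 'p) fm"
  | All nat "('f, 'p) fm"
  | Ex nat "('f, 'p) fm"

fun vars_tm :: "'f tm \<Rightarrow> var set" where
  "vars_tm (Var v) = {v}"
| "vars_tm (Fn f ts) = (\<Union>t\<in>set ts. vars_tm t)"

text \<open>All variables that occur, including those that occur only next to a quantifier symbol.\<close>

fun vars_fm :: "('f, 'p) fm \<Rightarrow> var set" where
  "vars_fm Bot = {}"
| "vars_fm (Pred P ts) = (\<Union>t\<in>set ts. vars_tm t)"
| "vars_fm (Imp A B) = vars_fm A \<union> vars_fm B"
| "vars_fm (All x A) = insert (Bv x) (vars_fm A)"
| "vars_fm (Ex x A) = insert (Bv x) (vars_fm A)"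

fun subst_tm :: "var \<Rightarrow> 'f tm \<Rightarrow> 'f tm \<Rightarrow> 'f tm" where
  "subst_tm v s (Var w) = (if w = v then s else Var w)"
| "subst_tm v s (Fn f ts) = Fn f (map (subst_tm v s) ts)"

text \<open>\<open>subst v s A\<close> replaces the free occurrences of \<open>v\<close> in \<open>A\<close> by \<open>s\<close>. For \<open>v = Fv a\<close> these are
  all occurrences, so \<open>subst (Fv a) (Var (Bv x)) A\<close> is \<open>A[x/a]\<close>; for \<open>v = Bv x\<close> the result is \<open>A(s)\<close>.
  No renaming is needed: \<open>x\<close> does not occur in \<open>A\<close> in the first case, and in the second \<open>s\<close> is a
  term, which contains no bound variables.\<close>

fun subst :: "var \<Rightarrow> 'f tm \<Rightarrow> ('f, 'p) fm \<Rightarrow> ('f, 'p) fm" where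
  "subst v s Bot = Bot"
| "subst v s (Pred P ts) = Pred P (map (subst_tm v s) ts)"
| "subst v s (Imp A B) = Imp (subst v s A) (subst v s B)"
| "subst v s (All x A) = All x (if v = Bv x then A else subst v s A)"
| "subst v s (Ex x A) = Ex x (if v = Bv x then A else subst v s A)"

inductive lterm :: "('f, 'p) lang \<Rightarrow> 'f tm \<Rightarrow> bool" for L where
  "lterm L (Var (Fv a))"
| "f \<in> funs L \<Longrightarrow> length ts = farity L f \<Longrightarrow> (\<forall>t\<in>set ts. lterm L t) \<Longrightarrow> lterm L (Fn f ts)"

inductive formula :: "('f, 'p) lang \<Rightarrow> ('f, 'p) fm \<Rightarrow> bool" for L where
  "formula L Bot"
| "P \<in> preds L \<Longrightarrow> length ts = parity L P \<Longrightarrow> (\<forall>t\<in>set ts. lterm L t) \<Longrightarrow> formula L (Pred P ts)"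
| "formula L A \<Longrightarrow> formula L B \<Longrightarrow> formula L (Imp A B)"
| "formula L A \<Longrightarrow> Bv x \<notin> vars_fm A \<Longrightarrow> formula L (All x (subst (Fv a) (Var (Bv x)) A))"
| "formula L A \<Longrightarrow> Bv x \<notin> vars_fm A \<Longrightarrow> formula L (Ex x (subst (Fv a) (Var (Bv x)) A))"

fun qfree :: "('f, 'p) fm \<Rightarrow> bool" where
  "qfree Bot = True"
| "qfree (Pred P ts) = True"
| "qfree (Imp A B) = (qfree A \<and> qfree B)"
| "qfree (All x A) = False"
| "qfree (Ex x A) = False"

inductive prenex :: "('f, 'p) fm \<Rightarrow> bool" where
  "qfree A \<Longrightarrow> prenex A"
| "prenex A \<Longrightarrow> prenex (All x A)"
| "prenex A \<Longrightarrow> prenex (Ex x A)"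

text \<open>The pair \<open>(\<Gamma>, \<Delta>)\<close> is the sequent with antecedent \<open>\<Gamma>\<close> and succedent \<open>\<Delta>\<close>.\<close>

type_synonym ('f, 'p) sequent = "('f, 'p) fm multiset \<times> ('f, 'p) fm multiset"
type_synonym ('f, 'p) hypersequent = "('f, 'p) sequent multiset"

definition formulas_seq :: "('f, 'p) sequent \<Rightarrow> ('f, 'p) fm set" where
  "formulas_seq S = set_mset (fst S) \<union> set_mset (snd S)"

definition formulas_hs :: "('f, 'p) hypersequent \<Rightarrow> ('f, 'p) fm set" where
  "formulas_hs G = (\<Union>S\<in>set_mset G. formulas_seq S)"

definition vars_hs :: "('f, 'p) hypersequent \<Rightarrow> var set" where
  "vars_hs G = (\<Union>A\<in>formulas_hs G. vars_fm A)"

definition lang_theory :: "('f, 'p) lang \<Rightarrow> ('f, 'p) fm set \<Rightarrow> bool" where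
  "lang_theory L T \<longleftrightarrow> (\<forall>A\<in>T. formula L A)"

definition lang_hs :: "('f, 'p) lang \<Rightarrow> ('f, 'p) hypersequent \<Rightarrow> bool" where
  "lang_hs L G \<longleftrightarrow> (\<forall>A\<in>formulas_hs G. formula L A)"

definition prenex_hs :: "('f, 'p) hypersequent \<Rightarrow> bool" where
  "prenex_hs G \<longleftrightarrow> (\<forall>A\<in>formulas_hs G. prenex A)"

definition propositional_hs :: "('f, 'p) hypersequent \<Rightarrow> bool" where
  "propositional_hs G \<longleftrightarrow> (\<forall>A\<in>formulas_hs G. qfree A)"


section \<open>Affine semantics on the unit interval (0 is truth, 1 is falsity)\<close>

record ('f, 'p, 'm) struct =
  univ :: "'m set"
  fint :: "'f \<Rightarrow> 'm list \<Rightarrow> 'm"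
  pint :: "'p \<Rightarrow> 'm list \<Rightarrow> real"

definition is_interpretation :: "('f, 'p) lang \<Rightarrow> ('f, 'p, 'm) struct \<Rightarrow> (var \<Rightarrow> 'm) \<Rightarrow> bool" where
  "is_interpretation L M \<beta> \<longleftrightarrow>
     univ M \<noteq> {} \<and>
     (\<forall>f\<in>funs L. \<forall>ms\<in>lists (univ M). length ms = farity L f \<longrightarrow> fint M f ms \<in> univ M) \<and>
     (\<forall>P\<in>preds L. \<forall>ms\<in>lists (univ M). length ms = parity L P \<longrightarrow> pint M P ms \<in> {0..1}) \<and>
     (\<forall>v. \<beta> v \<in> univ M)"

fun val_tm :: "('f, 'p, 'm) struct \<Rightarrow> (var \<Rightarrow> 'm) \<Rightarrow> 'f tm \<Rightarrow> 'm" where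
  "val_tm M \<beta> (Var v) = \<beta> v"
| "val_tm M \<beta> (Fn f ts) = fint M f (map (val_tm M \<beta>) ts)"

fun val_fm :: "('f, 'p, 'm) struct \<Rightarrow> (var \<Rightarrow> 'm) \<Rightarrow> ('f, 'p) fm \<Rightarrow> real" where
  "val_fm M \<beta> Bot = 1"
| "val_fm M \<beta> (Pred P ts) = pint M P (map (val_tm M \<beta>) ts)"
| "val_fm M \<beta> (Imp A B) = max (val_fm M \<beta> B - val_fm M \<beta> A) 0"
| "val_fm M \<beta> (All x A) = (SUP m\<in>univ M. val_fm M (\<beta>(Bv x := m)) A)"
| "val_fm M \<beta> (Ex x A) = (INF m\<in>univ M. val_fm M (\<beta>(Bv x := m)) A)"

definition val_seq :: "('f, 'p, 'm) struct \<Rightarrow> (var \<Rightarrow> 'm) \<Rightarrow> ('f, 'p) sequent \<Rightarrow> real" where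
  "val_seq M \<beta> S = (\<Sum>A\<in>#snd S. val_fm M \<beta> A) - (\<Sum>A\<in>#fst S. val_fm M \<beta> A)"

text \<open>Extended reals are used so that the empty hypersequent has value \<open>\<infinity>\<close> and hence is not true.\<close>

definition val_hs :: "('f, 'p, 'm) struct \<Rightarrow> (var \<Rightarrow> 'm) \<Rightarrow> ('f, 'p) hypersequent \<Rightarrow> ereal" where
  "val_hs M \<beta> G = (INF S\<in>set_mset G. ereal (val_seq M \<beta> S))"

definition true_hs :: "('f, 'p, 'm) struct \<Rightarrow> (var \<Rightarrow> 'm) \<Rightarrow> ('f, 'p) hypersequent \<Rightarrow> bool" where
  "true_hs M \<beta> G \<longleftrightarrow> val_hs M \<beta> G \<le> 0"

definition is_model ::
    "('f, 'p) lang \<Rightarrow> ('f, 'p) fm set \<Rightarrow> ('f, 'p, 'm) struct \<Rightarrow> (var \<Rightarrow> 'm) \<Rightarrow> bool" where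
  "is_model L T M \<beta> \<longleftrightarrow>
     is_interpretation L M \<beta> \<and> (\<forall>A\<in>T. true_hs M \<beta> {#({#}, {#A#})#})"

text \<open>HOL cannot quantify over types inside a formula, so the consequence relation carries the
  ambient type \<open>'m\<close> as a parameter: universes range over the nonempty subsets of \<open>'m\<close>.\<close>

definition entails ::
    "'m itself \<Rightarrow> ('f, 'p) lang \<Rightarrow> ('f, 'p) fm set \<Rightarrow> ('f, 'p) hypersequent \<Rightarrow> bool" where
  "entails _ L T G \<longleftrightarrow>
     (\<forall>(M :: ('f, 'p, 'm) struct) \<beta>. is_model L T M \<beta> \<longrightarrow> true_hs M \<beta> G)"


section \<open>Approximations\<close>

definition approx_seq :: "nat \<Rightarrow> ('f, 'p) sequent \<Rightarrow> ('f, 'p) sequent" where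
  "approx_seq n S = (add_mset Bot (repeat_mset n (fst S)), repeat_mset n (snd S))"

definition approx_hs :: "nat \<Rightarrow> ('f, 'p) hypersequent \<Rightarrow> ('f, 'p) hypersequent" where
  "approx_hs n G = image_mset (approx_seq n) G"


section \<open>Derivations\<close>

text \<open>In both calculi the language side conditions are placed on exactly those formulas of the
  conclusion that are not already controlled by the premises. Thus every hypersequent derived in
  \<open>GL L\<close> is a propositional \<open>L\<close>-hypersequent, and \<open>quant_derivable L n H\<close> only derives
  \<open>L\<close>-hypersequents if \<open>H\<close> is one.\<close>

inductive GL :: "('f, 'p) lang \<Rightarrow> ('f, 'p) hypersequent \<Rightarrow> bool" for L where
  ax_id: "formula L A \<Longrightarrow> qfree A \<Longrightarrow> GL L {#({#A#}, {#A#})#}"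
| ax_empty: "GL L {#({#}, {#})#}"
| ax_bot: "formula L A \<Longrightarrow> qfree A \<Longrightarrow> GL L {#({#Bot#}, {#A#})#}"
| EW: "GL L G \<Longrightarrow> G \<noteq> {#} \<Longrightarrow> \<forall>A\<in>formulas_seq S. formula L A \<and> qfree A \<Longrightarrow> GL L (add_mset S G)"
| EC: "GL L (add_mset S (add_mset S G)) \<Longrightarrow> GL L (add_mset S G)"
| IW: "GL L (add_mset (\<Gamma>, \<Delta>) G) \<Longrightarrow> formula L A \<Longrightarrow> qfree A \<Longrightarrow>
       GL L (add_mset (add_mset A \<Gamma>, \<Delta>) G)"
| Split: "GL L (add_mset (\<Gamma>1 + \<Gamma>2, \<Delta>1 + \<Delta>2) G) \<Longrightarrow>
       GL L (add_mset (\<Gamma>1, \<Delta>1) (add_mset (\<Gamma>2, \<Delta>2) G))"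
| Mix: "GL L (add_mset (\<Gamma>1, \<Delta>1) G) \<Longrightarrow> GL L (add_mset (\<Gamma>2, \<Delta>2) G) \<Longrightarrow>
       GL L (add_mset (\<Gamma>1 + \<Gamma>2, \<Delta>1 + \<Delta>2) G)"
| Imp_left: "GL L (add_mset (\<Gamma>, \<Delta>) (add_mset (add_mset B \<Gamma>, add_mset A \<Delta>) G)) \<Longrightarrow>
       GL L (add_mset (add_mset (Imp A B) \<Gamma>, \<Delta>) G)"
| Imp_right: "GL L (add_mset (\<Gamma>, \<Delta>) G) \<Longrightarrow> GL L (add_mset (add_mset A \<Gamma>, add_mset B \<Delta>) G) \<Longrightarrow>
       GL L (add_mset (\<Gamma>, add_mset (Imp A B) \<Delta>) G)"

text \<open>\<open>quant_derivable L n H H'\<close>: \<open>H'\<close> is obtained from \<open>H\<close> by finitely many applications of the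
  approximate quantifier rules for \<open>n\<close> together with external weakening and contraction.\<close>

inductive quant_derivable ::
    "('f, 'p) lang \<Rightarrow> nat \<Rightarrow> ('f, 'p) hypersequent \<Rightarrow> ('f, 'p) hypersequent \<Rightarrow> bool"
  for L n H where
  start: "quant_derivable L n H H"
| EW: "quant_derivable L n H G \<Longrightarrow> G \<noteq> {#} \<Longrightarrow> \<forall>A\<in>formulas_seq S. formula L A \<Longrightarrow>
       quant_derivable L n H (add_mset S G)"
| EC: "quant_derivable L n H (add_mset S (add_mset S G)) \<Longrightarrow> quant_derivable L n H (add_mset S G)"
| All_left: "quant_derivable L n H (add_mset (approx_seq n (add_mset (subst (Bv x) t A) \<Gamma>, \<Delta>)) G) \<Longrightarrow>
       lterm L t \<Longrightarrow> formula L (All x A) \<Longrightarrow>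
       quant_derivable L n H (add_mset (approx_seq n (add_mset (All x A) \<Gamma>, \<Delta>)) G)"
| All_right: "quant_derivable L n H
         (add_mset (approx_seq n (\<Gamma>, add_mset (subst (Bv x) (Var (Fv a)) A) \<Delta>)) G) \<Longrightarrow>
       Fv a \<notin> vars_hs (add_mset (approx_seq n (\<Gamma>, add_mset (All x A) \<Delta>)) G) \<Longrightarrow>
       formula L (All x A) \<Longrightarrow>
       quant_derivable L n H (add_mset (approx_seq n (\<Gamma>, add_mset (All x A) \<Delta>)) G)"
| Ex_left: "quant_derivable L n H
         (add_mset (approx_seq n (add_mset (subst (Bv x) (Var (Fv a)) A) \<Gamma>, \<Delta>)) G) \<Longrightarrow>
       Fv a \<notin> vars_hs (add_mset (approx_seq n (add_mset (Ex x A) \<Gamma>, \<Delta>)) G) \<Longrightarrow>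
       formula L (Ex x A) \<Longrightarrow>
       quant_derivable L n H (add_mset (approx_seq n (add_mset (Ex x A) \<Gamma>, \<Delta>)) G)"
| Ex_right: "quant_derivable L n H (add_mset (approx_seq n (\<Gamma>, add_mset (subst (Bv x) t A) \<Delta>)) G) \<Longrightarrow>
       lterm L t \<Longrightarrow> formula L (Ex x A) \<Longrightarrow>
       quant_derivable L n H (add_mset (approx_seq n (\<Gamma>, add_mset (Ex x A) \<Delta>)) G)"

end

theory Submission
  imports Defs "HOL-Analysis.Function_Topology" "HOL-Library.Function_Algebras"
    "HOL-Library.Product_Plus"
begin

text \<open>
  The proof is by contraposition and has the shape of Henkin's completeness proof. Add to the
  sequents of \<open>G\<close> the sequents \<open>m C \<Rightarrow> \<bottom>\<close> with \<open>C \<in> T\<close> and \<open>m > 0\<close>, and call a set of sequents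
  consistent if no finite hypersequent over it has an approximation that can be reached by the
  approximate quantifier rules from a hypersequent derivable in \<open>GL\<close>. External weakening and
  contraction make the multiplicities in such a hypersequent irrelevant. So an inconsistency of
  this set, weakened by \<open>G\<close>, is what the theorem asks for, and it remains to refute consistency.

  A consistent set extends to a maximal consistent one, in which every sequent with a universal
  formula on the right or an existential one on the left is accompanied by an instance with a fresh
  variable (\<open>henkin_extension\<close>). By maximality it also contains all instances of universal formulas
  on the left and existential ones on the right. Each finite set of its quantifier-free sequents has underivable
  approximation, so by completeness of \<open>GL\<close> (\<open>GL_complete\<close>) some valuation gives all of them a value
  above \<open>1/n\<close>: the approximation of a sequent of value \<open>s\<close> has value \<open>n s - 1\<close>. By Tychonoff's
  theorem one valuation gives value at least \<open>1/n\<close> to all quantifier-free sequents in the set. In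
  the term model of this valuation the bound passes up to all sequents (\<open>truth_lemma\<close>), because a
  supremum or infimum over terms respects a weak inequality. Hence \<open>1 - m \<lbrakk>C\<rbrakk> \<ge> 1/n\<close> for all \<open>m\<close>,
  which forces \<open>\<lbrakk>C\<rbrakk> = 0\<close> for \<open>C \<in> T\<close>, while every sequent of \<open>G\<close> has value at least \<open>1/n > 0\<close>.
  This contradicts \<open>T \<Turnstile> G\<close>.

  Two points need extra work. First, \<open>T\<close> may use up all free variables, so that no fresh ones
  remain; renaming every variable number to its double makes room, and a derivation, being finite,
  can be renamed back injectively. Second, completeness of \<open>GL\<close> reduces, through the invertible
  implication rules, to atomic hypersequents, where it is a theorem of the alternative for integer
  linear inequalities (\<open>gordan\<close>): if a hypersequent is valid, then some sum of its sequents,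
  repetitions allowed, is a valid sequent, and splitting this sum derives the hypersequent.
\<close>

section \<open>Substitution\<close>

inductive_cases formula_ImpE: "formula L (Imp A B)"
inductive_cases formula_AllE: "formula L (All x A)"
inductive_cases formula_ExE: "formula L (Ex x A)"

text \<open>Substituting for all free variables at once gives an induction over \<open>formula\<close> that a
substitution for a single variable would not: under a quantifier the abstracted variable has to be
renamed as well, and the renaming is absorbed into \<open>\<sigma>\<close>.\<close>
fun psubst_tm :: "(nat \<Rightarrow> 'f tm) \<Rightarrow> 'f tm \<Rightarrow> 'f tm" where
  "psubst_tm \<sigma> (Var (Fv a)) = \<sigma> a"
| "psubst_tm \<sigma> (Var (Bv x)) = Var (Bv x)"
| "psubst_tm \<sigma> (Fn f ts) = Fn f (map (psubst_tm \<sigma>) ts)"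

fun psubst :: "(nat \<Rightarrow> 'f tm) \<Rightarrow> ('f, 'p) fm \<Rightarrow> ('f, 'p) fm" where
  "psubst \<sigma> Bot = Bot"
| "psubst \<sigma> (Pred P ts) = Pred P (map (psubst_tm \<sigma>) ts)"
| "psubst \<sigma> (Imp A B) = Imp (psubst \<sigma> A) (psubst \<sigma> B)"
| "psubst \<sigma> (All x A) = All x (psubst \<sigma> A)"
| "psubst \<sigma> (Ex x A) = Ex x (psubst \<sigma> A)"

lemma lterm_Bv: "lterm L t \<Longrightarrow> Bv x \<notin> vars_tm t"
  by (induction rule: lterm.induct) auto

lemma finite_vars_tm [simp]: "finite (vars_tm t)"
  by (induction t) auto

lemma finite_vars_fm [simp]: "finite (vars_fm A)"
  by (induction A) auto

lemma lterm_psubst: "lterm L t \<Longrightarrow> (\<And>a. lterm L (\<sigma> a)) \<Longrightarrow> lterm L (psubst_tm \<sigma> t)"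
  by (induction rule: lterm.induct) (auto intro!: lterm.intros)

lemma vars_psubst_tm: "(\<And>a. Bv x \<notin> vars_tm (\<sigma> a)) \<Longrightarrow> Bv x \<in> vars_tm (psubst_tm \<sigma> t) \<longleftrightarrow> Bv x \<in> vars_tm t"
  by (induction \<sigma> t rule: psubst_tm.induct) auto

lemma vars_psubst: "(\<And>a. Bv x \<notin> vars_tm (\<sigma> a)) \<Longrightarrow> Bv x \<in> vars_fm (psubst \<sigma> A) \<longleftrightarrow> Bv x \<in> vars_fm A"
  by (induction A) (auto simp: vars_psubst_tm)

lemma subst_tm_fresh: "v \<notin> vars_tm t \<Longrightarrow> subst_tm v s t = t"
  by (induction t) (auto intro: map_idI)

text \<open>The variable \<open>b\<close> abstracted by a quantifier may occur in the terms substituted for other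
variables; replacing it by a variable \<open>c\<close> that avoids those terms removes the clash.\<close>
lemma psubst_tm_rename:
  "(\<And>d. Fv d \<in> vars_tm t \<Longrightarrow> d \<noteq> b \<Longrightarrow> Fv c \<notin> vars_tm (\<sigma> d)) \<Longrightarrow>
   psubst_tm \<sigma> (subst_tm (Fv b) (Var (Bv x)) t) =
   subst_tm (Fv c) (Var (Bv x)) (psubst_tm (\<sigma>(b := Var (Fv c))) t)"
proof (induction t)
  case (Var v) then show ?case by (cases v) (auto simp: subst_tm_fresh)
next
  case (Fn f ts) then show ?case by auto
qed

lemma psubst_rename:
  "(\<And>d. Fv d \<in> vars_fm A \<Longrightarrow> d \<noteq> b \<Longrightarrow> Fv c \<notin> vars_tm (\<sigma> d)) \<Longrightarrow>
   psubst \<sigma> (subst (Fv b) (Var (Bv x)) A) =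
   subst (Fv c) (Var (Bv x)) (psubst (\<sigma>(b := Var (Fv c))) A)"
  by (induction A) (auto intro!: psubst_tm_rename)

lemma fresh_Fv: "finite V \<Longrightarrow> \<exists>c. Fv c \<notin> V"
proof -
  assume "finite V"
  then have "finite (Fv -` V)" by (intro finite_vimageI) (auto simp: inj_def)
  then obtain c where "c \<notin> Fv -` V" using ex_new_if_finite infinite_UNIV_nat by blast
  then show ?thesis by auto
qed

lemma formula_psubst:
  assumes "formula L A" and "\<And>a. lterm L (\<sigma> a)"
  shows "formula L (psubst \<sigma> A)"
proof -
  have quant: "\<exists>c B. formula L B \<and> Bv x \<notin> vars_fm B \<and>
      psubst \<sigma> (subst (Fv b) (Var (Bv x)) A) = subst (Fv c) (Var (Bv x)) B"
    if IH: "\<And>\<sigma>. (\<And>a. lterm L (\<sigma> a)) \<Longrightarrow> formula L (psubst \<sigma> A)"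
      and x: "Bv x \<notin> vars_fm A" and \<sigma>: "\<And>a. lterm L (\<sigma> a)" for x b A \<sigma>
  proof -
    \<comment> \<open>Only finitely many terms are actually substituted into \<open>A\<close>, so a suitable \<open>c\<close> exists.\<close>
    have "finite (\<Union>d\<in>Fv -` vars_fm A. vars_tm (\<sigma> d))"
      by (intro finite_UN_I finite_vimageI) (auto simp: inj_def)
    then obtain c where c: "Fv c \<notin> (\<Union>d\<in>Fv -` vars_fm A. vars_tm (\<sigma> d))"
      using fresh_Fv by metis
    have l: "lterm L ((\<sigma>(b := Var (Fv c))) a)" for a
      using \<sigma> by (auto intro: lterm.intros)
    have "Bv x \<notin> vars_fm (psubst (\<sigma>(b := Var (Fv c))) A)"
      using x by (simp only: vars_psubst[OF lterm_Bv[OF l]] not_False_eq_True)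
    moreover have "psubst \<sigma> (subst (Fv b) (Var (Bv x)) A) =
        subst (Fv c) (Var (Bv x)) (psubst (\<sigma>(b := Var (Fv c))) A)"
      by (rule psubst_rename) (use c in auto)
    ultimately show ?thesis using IH[OF l] by (intro exI conjI)
  qed
  show ?thesis using assms
  proof (induction arbitrary: \<sigma> rule: formula.induct)
    case 1 show ?case by (auto intro: formula.intros)
  next
    case (2 P ts) then show ?case by (auto intro!: formula.intros lterm_psubst)
  next
    case (3 A B) then show ?case by (auto intro!: formula.intros)
  next
    case (4 A x b)
    then show ?case using quant[of A x \<sigma> b] by (auto intro!: formula.intros)
  next
    case (5 A x b)
    then show ?case using quant[of A x \<sigma> b] by (auto intro!: formula.intros)
  qed
qed

text \<open>Every quantified formula arises by abstracting a free variable \<open>a\<close>, and instantiating it puts the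
term in place of \<open>a\<close>. This shows that instances are again formulas of the language.\<close>
lemma subst_abstracted:
  "Bv x \<notin> vars_fm A \<Longrightarrow>
   subst (Bv x) t (subst (Fv a) (Var (Bv x)) A) = psubst ((\<lambda>b. Var (Fv b))(a := t)) A"
proof -
  have tm: "subst_tm (Bv x) t (subst_tm (Fv a) (Var (Bv x)) s) = psubst_tm ((\<lambda>b. Var (Fv b))(a := t)) s"
    if "Bv x \<notin> vars_tm s" for s
    using that
  proof (induction s)
    case (Var v) then show ?case by (cases v) auto
  qed auto
  show "Bv x \<notin> vars_fm A \<Longrightarrow> ?thesis" by (induction A) (auto simp: tm)
qed

lemma formula_All_instance: "formula L (All x A) \<Longrightarrow> lterm L t \<Longrightarrow> formula L (subst (Bv x) t A)"
  by (erule formula_AllE) (auto simp: subst_abstracted intro!: formula_psubst lterm.intros)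

lemma formula_Ex_instance: "formula L (Ex x A) \<Longrightarrow> lterm L t \<Longrightarrow> formula L (subst (Bv x) t A)"
  by (erule formula_ExE) (auto simp: subst_abstracted intro!: formula_psubst lterm.intros)

fun quantifiers :: "('f, 'p) fm \<Rightarrow> nat" where
  "quantifiers (Imp A B) = quantifiers A + quantifiers B"
| "quantifiers (All x A) = Suc (quantifiers A)"
| "quantifiers (Ex x A) = Suc (quantifiers A)"
| "quantifiers _ = 0"

lemma quantifiers_subst [simp]: "quantifiers (subst v s A) = quantifiers A"
  by (induction A) auto

lemma qfree_subst [simp]: "qfree (subst v s A) = qfree A"
  by (induction A) auto

lemma prenex_subst: "prenex A \<Longrightarrow> prenex (subst v s A)"
  by (induction rule: prenex.induct) (auto intro: prenex.intros)

lemma prenex_cases: 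
  assumes "prenex A"
  obtains "qfree A" | x B where "A = All x B" "prenex B" | x B where "A = Ex x B" "prenex B"
  using assms by (cases rule: prenex.cases) auto

section \<open>Countability\<close>

text \<open>Only the symbols of the language are known to be countably many, so terms and formulas are
  counted by translating their symbols injectively to numbers.\<close>
instance var :: countable by countable_datatype
instance tm :: (countable) countable by countable_datatype
instance fm :: (countable, countable) countable by countable_datatype

lemma countable_lterms:
  assumes "countable (funs L)" shows "countable {t. lterm L t}"
proof -
  have s: "set_tm t \<subseteq> funs L" if "lterm L t" for t
    using that by (induction rule: lterm.induct) auto
  have "inj_on (map_tm (to_nat_on (funs L))) {t. lterm L t}"
  proof (rule inj_onI, rule tm.inj_map_strong)
    fix s t z z' assume "s \<in> {t. lterm L t}" "t \<in> {t. lterm L t}" "z \<in> set_tm s" "z' \<in> set_tm t"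
      "to_nat_on (funs L) z = to_nat_on (funs L) z'"
    then show "z = z'" using s[of s] s[of t] inj_onD[OF inj_on_to_nat_on[OF assms], of z z'] by auto
  qed auto
  then show ?thesis by (rule countableI')
qed

lemma set1_subst: "set1_fm (subst v s A) \<subseteq> set1_fm A \<union> set_tm s"
proof -
  have "set_tm (subst_tm v s t) \<subseteq> set_tm t \<union> set_tm s" for t by (induction t) auto
  then show ?thesis by (induction A) (simp_all, blast+)
qed

lemma set2_subst [simp]: "set2_fm (subst v s A) = set2_fm A"
  by (induction A) auto

lemma countable_formulas:
  assumes "countable_lang L" shows "countable {A. formula L A}"
proof -
  let ?f = "to_nat_on (funs L)" and ?p = "to_nat_on (preds L)"
  have c: "inj_on ?f (funs L)" "inj_on ?p (preds L)"
    using assms by (auto simp: countable_lang_def)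
  have l: "set_tm t \<subseteq> funs L" if "lterm L t" for t
    using that by (induction rule: lterm.induct) auto
  have s: "set1_fm A \<subseteq> funs L \<and> set2_fm A \<subseteq> preds L" if "formula L A" for A
    using that
  proof (induction rule: formula.induct)
    case (4 A x a) then show ?case using set1_subst[of "Fv a" "Var (Bv x)" A] by auto
  next
    case (5 A x a) then show ?case using set1_subst[of "Fv a" "Var (Bv x)" A] by auto
  qed (use l in auto)
  have "inj_on (map_fm ?f ?p) {A. formula L A}"
  proof (rule inj_onI, rule fm.inj_map_strong)
    fix A B z z' assume "A \<in> {A. formula L A}" "B \<in> {A. formula L A}" "z \<in> set1_fm A" "z' \<in> set1_fm B"
      "?f z = ?f z'"
    then show "z = z'" using s[of A] s[of B] inj_onD[OF c(1), of z z'] by auto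
  next
    fix A B z z' assume "A \<in> {A. formula L A}" "B \<in> {A. formula L A}" "z \<in> set2_fm A" "z' \<in> set2_fm B"
      "?p z = ?p z'"
    then show "z = z'" using s[of A] s[of B] inj_onD[OF c(2), of z z'] by auto
  qed auto
  then show ?thesis by (rule countableI')
qed

lemma countable_multisets: "countable A \<Longrightarrow> countable {M. set_mset M \<subseteq> A}"
proof -
  assume "countable A"
  then have "countable (mset ` lists A)" by simp
  moreover have "{M. set_mset M \<subseteq> A} \<subseteq> mset ` lists A"
  proof
    fix M assume "M \<in> {M. set_mset M \<subseteq> A}"
    moreover obtain xs where "M = mset xs" using ex_mset by metis
    ultimately show "M \<in> mset ` lists A" by auto
  qed
  ultimately show ?thesis using countable_subset by blast
qed

section \<open>Theorem of the alternative\<close>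

text \<open>The sums of elements of \<open>K\<close> with positive integer multiplicities. The same closure is used for
integer vectors and for sequents, which are added componentwise.\<close>
inductive_set cone :: "'a::ab_semigroup_add set \<Rightarrow> 'a set" for K where
  base: "f \<in> K \<Longrightarrow> f \<in> cone K"
| add: "f \<in> cone K \<Longrightarrow> g \<in> cone K \<Longrightarrow> f + g \<in> cone K"

lemma cone_subset: "K \<subseteq> cone K' \<Longrightarrow> cone K \<subseteq> cone K'"
proof
  fix f assume "K \<subseteq> cone K'" "f \<in> cone K"
  from this(2,1) show "f \<in> cone K'" by (induction rule: cone.induct) (auto intro: cone.add)
qed

text \<open>A sum over \<open>A \<union> B\<close> may lack summands from one of the two sets, and then that part is \<open>0\<close>; the last
conclusion says that not both parts are missing.\<close>
lemma cone_Un: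
  fixes A B :: "'a::comm_monoid_add set"
  assumes "f \<in> cone (A \<union> B)"
  obtains g h where "f = g + h" "g \<in> insert 0 (cone A)" "h \<in> insert 0 (cone B)"
    "g \<in> cone A \<or> h \<in> cone B"
proof -
  have plus: "x + y \<in> cone K" if "x \<in> insert 0 (cone K)" "y \<in> insert 0 (cone K)" "x \<in> cone K \<or> y \<in> cone K"
    for x y and K :: "'a set"
    using that by (auto intro: cone.add)
  from assms have "\<exists>g h. f = g + h \<and> g \<in> insert 0 (cone A) \<and> h \<in> insert 0 (cone B) \<and>
    (g \<in> cone A \<or> h \<in> cone B)"
  proof (induction rule: cone.induct)
    case (base f)
    then show ?case
    proof
      assume "f \<in> A"
      then show ?thesis by (intro exI[of _ f] exI[of _ 0]) (auto intro: cone.base)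
    next
      assume "f \<in> B"
      then show ?thesis by (intro exI[of _ 0] exI[of _ f]) (auto intro: cone.base)
    qed
  next
    case (add f f')
    then obtain g h g' h' where eq: "f = g + h" "f' = g' + h'"
      and g: "g \<in> insert 0 (cone A)" "g' \<in> insert 0 (cone A)"
      and h: "h \<in> insert 0 (cone B)" "h' \<in> insert 0 (cone B)"
      and gh: "g \<in> cone A \<or> h \<in> cone B"
      by blast
    have "f + f' = (g + g') + (h + h')" by (simp add: eq ac_simps)
    moreover have "g + g' \<in> insert 0 (cone A)" using g plus by auto
    moreover have "h + h' \<in> insert 0 (cone B)" using h plus by auto
    moreover have "g + g' \<in> cone A \<or> h + h' \<in> cone B" using gh g h plus by blast
    ultimately show ?case by blast
  qed
  then show ?thesis using that by blast
qed

lemma cone_image: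
  assumes "\<And>x y. h (x + y) = h x + h y" and "f \<in> cone (h ` K)"
  shows "f \<in> h ` cone K"
  using assms(2)
proof (induction rule: cone.induct)
  case (add f g)
  then obtain x y where "x \<in> cone K" "y \<in> cone K" "f = h x" "g = h y" by auto
  then show ?case using assms(1) cone.add by (metis imageI)
qed (auto intro: cone.base)

lemma cone_scale:
  fixes K :: "('a \<Rightarrow> int) set"
  assumes "f \<in> cone K" "c > 0"
  shows "(\<lambda>a. c * f a) \<in> cone K"
proof -
  have "(\<lambda>a. int (Suc k) * f a) \<in> cone K" for k
  proof (induction k)
    case 0 then show ?case using assms by simp
  next
    case (Suc k)
    have "(\<lambda>a. int (Suc (Suc k)) * f a) = f + (\<lambda>a. int (Suc k) * f a)"
      by (auto simp: fun_eq_iff algebra_simps)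
    then show ?case using cone.add[OF assms(1) Suc.IH] by simp
  qed
  from this[of "nat (c - 1)"] show ?thesis using assms(2) by simp
qed

lemma strictly_between:
  fixes A B :: "real set"
  assumes "finite A" "finite B" "\<And>a b. a \<in> A \<Longrightarrow> b \<in> B \<Longrightarrow> a < b"
  shows "\<exists>r. (\<forall>a\<in>A. a < r) \<and> (\<forall>b\<in>B. r < b)"
proof (cases "A = {} \<or> B = {}")
  case True
  then show ?thesis
  proof
    assume "A = {}"
    obtain r where "\<forall>b\<in>B. r < b" using assms(2)
      by (metis Min_le bot.extremum_strict all_not_in_conv gt_ex lt_ex order.strict_trans2)
    then show ?thesis using \<open>A = {}\<close> by auto
  next
    assume "B = {}"
    obtain r where "\<forall>a\<in>A. a < r" using assms(1)
      by (metis Max_ge gt_ex order.strict_trans1)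
    then show ?thesis using \<open>B = {}\<close> by auto
  qed
next
  case False
  then have "Max A < Min B" using assms by simp
  then obtain r where "Max A < r" "r < Min B" using dense by blast
  then show ?thesis using assms False by auto
qed

text \<open>The induction on the number of unknowns is Fourier--Motzkin elimination of \<open>x\<close>. Each inequality
with a positive coefficient of \<open>x\<close> bounds \<open>x\<close> from below, and each with a negative coefficient from
above. The combinations \<open>comb f g\<close>, in which \<open>x\<close> cancels, say that every lower bound is less than
every upper bound. Their coefficients are positive integers, so integrality is kept throughout.\<close>
lemma gordan:
  fixes K :: "('a \<Rightarrow> int) set"
  assumes "finite V" "finite K" "\<And>f a. f \<in> K \<Longrightarrow> a \<notin> V \<Longrightarrow> f a = 0"
  shows "(\<exists>v::'a \<Rightarrow> real. \<forall>f\<in>K. 0 < (\<Sum>a\<in>V. real_of_int (f a) * v a)) \<or> (\<lambda>a. 0) \<in> cone K"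
  using assms
proof (induction V arbitrary: K rule: finite_induct)
  case empty
  show ?case
  proof (cases "K = {}")
    case False
    then obtain f where "f \<in> K" by auto
    moreover have "f = (\<lambda>a. 0)" using empty.prems(2)[OF \<open>f \<in> K\<close>] by auto
    ultimately show ?thesis using cone.base by metis
  qed simp
next
  case (insert x V)
  define comb where "comb = (\<lambda>f g a. (- g x) * f a + f x * g a :: int)"
  define P where "P = {f\<in>K. f x > 0}"
  define N where "N = {f\<in>K. f x < 0}"
  define K' where "K' = {f\<in>K. f x = 0} \<union> (\<lambda>(f, g). comb f g) ` (P \<times> N)"
  have fin: "finite P" "finite N" using insert.prems by (auto simp: P_def N_def)
  have "finite K'" using fin insert.prems by (simp add: K'_def)
  have vanish: "f a = 0" if f: "f \<in> K'" and a: "a \<notin> V" for f a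
  proof -
    have K: "g a = 0" if "g \<in> K" "a \<noteq> x" for g
      using insert.prems(2)[OF \<open>g \<in> K\<close>, of a] a that by simp
    consider "f \<in> K" "f x = 0" | g h where "f = comb g h" "g \<in> K" "h \<in> K"
      using f by (auto simp: K'_def P_def N_def)
    then show ?thesis
    proof cases
      case 1
      then show ?thesis using K[OF 1(1)] by (cases "a = x") simp_all
    next
      case 2
      then show ?thesis using K[OF 2(2)] K[OF 2(3)] by (cases "a = x") (simp_all add: comb_def)
    qed
  qed
  have "K' \<subseteq> cone K"
  proof
    fix h assume "h \<in> K'"
    moreover have "comb f g \<in> cone K" if "f \<in> P" "g \<in> N" for f g
    proof -
      have "comb f g = (\<lambda>a. (- g x) * f a) + (\<lambda>a. f x * g a)"
        by (auto simp: comb_def fun_eq_iff)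
      moreover have "(\<lambda>a. (- g x) * f a) \<in> cone K" "(\<lambda>a. f x * g a) \<in> cone K"
        using that cone_scale[OF cone.base, of f K "- g x"] cone_scale[OF cone.base, of g K "f x"]
        by (auto simp: P_def N_def)
      ultimately show ?thesis by (metis cone.add)
    qed
    ultimately show "h \<in> cone K" by (auto simp: K'_def intro: cone.base)
  qed
  have "(\<exists>v::'a \<Rightarrow> real. \<forall>f\<in>K'. 0 < (\<Sum>a\<in>V. real_of_int (f a) * v a)) \<or> (\<lambda>a. 0) \<in> cone K'"
    by (rule insert.IH) (use \<open>finite K'\<close> vanish in auto)
  then show ?case
  proof (elim disjE)
    assume "(\<lambda>a. 0) \<in> cone K'"
    then show ?thesis using cone_subset[OF \<open>K' \<subseteq> cone K\<close>] by blast
  next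
    assume "\<exists>v::'a \<Rightarrow> real. \<forall>f\<in>K'. 0 < (\<Sum>a\<in>V. real_of_int (f a) * v a)"
    then obtain v :: "'a \<Rightarrow> real" where v: "\<And>f. f \<in> K' \<Longrightarrow> 0 < (\<Sum>a\<in>V. real_of_int (f a) * v a)"
      by blast
    define s where "s f = (\<Sum>a\<in>V. real_of_int (f a) * v a)" for f
    have between: "- s f / f x < - s g / g x" if "f \<in> P" "g \<in> N" for f g
    proof -
      have "comb f g \<in> K'" using that by (auto simp: K'_def)
      from v[OF this] have "0 < (\<Sum>a\<in>V. (- g x) * (real_of_int (f a) * v a) + f x * (real_of_int (g a) * v a))"
        by (simp add: comb_def algebra_simps)
      also have "\<dots> = (- g x) * s f + f x * s g"
        by (simp only: sum.distrib s_def sum_distrib_left)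
      finally have *: "0 < (- g x) * s f + f x * s g" .
      have "real_of_int (f x) > 0" "real_of_int (g x) < 0" using that by (auto simp: P_def N_def)
      with * show ?thesis by (simp add: field_simps)
    qed
    have "\<exists>r. (\<forall>a\<in>(\<lambda>f. - s f / f x) ` P. a < r) \<and> (\<forall>b\<in>(\<lambda>f. - s f / f x) ` N. r < b)"
    proof (rule strictly_between)
      fix a b assume "a \<in> (\<lambda>f. - s f / f x) ` P" "b \<in> (\<lambda>f. - s f / f x) ` N"
      then show "a < b" using between by blast
    qed (use fin in auto)
    then obtain r where "(\<forall>a\<in>(\<lambda>f. - s f / f x) ` P. a < r) \<and> (\<forall>b\<in>(\<lambda>f. - s f / f x) ` N. r < b)"
      by (rule exE)
    then have r: "\<forall>f\<in>P. - s f / f x < r" "\<forall>f\<in>N. r < - s f / f x"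
      by simp_all
    have "0 < (\<Sum>a\<in>insert x V. real_of_int (f a) * (v(x := r)) a)" if "f \<in> K" for f
    proof -
      have "(\<Sum>a\<in>V. real_of_int (f a) * (v(x := r)) a) = s f"
        unfolding s_def by (rule sum.cong) (use insert.hyps in auto)
      then have eq: "(\<Sum>a\<in>insert x V. real_of_int (f a) * (v(x := r)) a) = f x * r + s f"
        using insert.hyps by simp
      consider "f x = 0" | "f x > 0" | "f x < 0" by linarith
      then show ?thesis
      proof cases
        case 1
        then have "f \<in> K'" using that by (simp add: K'_def)
        from v[OF this] show ?thesis using eq 1 by (simp add: s_def)
      next
        case 2
        then have "- s f / f x < r" "real_of_int (f x) > 0" using that r(1) by (auto simp: P_def)
        then show ?thesis unfolding eq by (simp add: field_simps)
      next
        case 3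
        then have "r < - s f / f x" "real_of_int (f x) < 0" using that r(2) by (auto simp: N_def)
        then show ?thesis unfolding eq by (simp add: field_simps)
      qed
    qed
    then show ?thesis by blast
  qed
qed

section \<open>Completeness of GL\<close>

text \<open>The affine semantics of quantifier-free formulas, with atomic formulas in the role of propositional
variables. Indexing valuations by all formulas makes the unit cube a plain power of the unit
interval, to which Tychonoff's theorem applies.\<close>
fun pval :: "(('f, 'p) fm \<Rightarrow> real) \<Rightarrow> ('f, 'p) fm \<Rightarrow> real" where
  "pval v Bot = 1"
| "pval v (Imp A B) = max (pval v B - pval v A) 0"
| "pval v A = v A"

definition pval_seq :: "(('f, 'p) fm \<Rightarrow> real) \<Rightarrow> ('f, 'p) sequent \<Rightarrow> real" where
  "pval_seq v S = (\<Sum>A\<in>#snd S. pval v A) - (\<Sum>A\<in>#fst S. pval v A)"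

definition unit_valuation :: "('a \<Rightarrow> real) \<Rightarrow> bool" where
  "unit_valuation v \<longleftrightarrow> (\<forall>A. 0 \<le> v A \<and> v A \<le> 1)"

lemma GL_language: "GL L H \<Longrightarrow> lang_hs L H \<and> propositional_hs H"
proof (induction rule: GL.induct)
  case (Imp_left \<Gamma> \<Delta> B A G)
  then show ?case by (auto simp: lang_hs_def propositional_hs_def formulas_hs_def formulas_seq_def intro: formula.intros)
next
  case (Imp_right \<Gamma> \<Delta> G A B)
  then show ?case by (auto simp: lang_hs_def propositional_hs_def formulas_hs_def formulas_seq_def intro: formula.intros)
qed (auto simp: lang_hs_def propositional_hs_def formulas_hs_def formulas_seq_def intro: formula.intros)

lemma GL_weaken:
  assumes "GL L G" "lang_hs L H" "propositional_hs H"
  shows "GL L (H + G)"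
  using assms(2,3)
proof (induction H)
  case empty then show ?case using assms(1) by simp
next
  case (add S H)
  have "G \<noteq> {#}" 
  proof -
    have "H \<noteq> {#}" if "GL L H" for H using that by (induction) auto
    then show ?thesis using assms(1) by blast
  qed
  with add show ?case
    by (auto simp: lang_hs_def propositional_hs_def formulas_hs_def intro!: GL.EW)
qed

text \<open>A sum of sequents of the hypersequent can be split into its summands, and these are contracted into
the copies that are already present.\<close>
lemma GL_cone:
  "S \<in> cone (set_mset H) \<Longrightarrow> H \<subseteq># H' \<Longrightarrow> GL L (add_mset S H') \<Longrightarrow> GL L H'"
proof (induction arbitrary: H' rule: cone.induct)
  case (base S)
  then obtain H'' where "H' = add_mset S H''"
    by (metis insert_DiffM mset_subset_eqD)
  then show ?case using base GL.EC by metis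
next
  case (add S1 S2)
  have "GL L (add_mset S1 (add_mset S2 H'))"
    using add.prems(2) GL.Split[of L "fst S1" "fst S2" "snd S1" "snd S2" H'] by (simp add: plus_prod_def)
  then have "GL L (add_mset S2 H')"
    by (rule add.IH(1)[rotated]) (use add.prems in \<open>metis add_mset_add_single mset_subset_eq_add_left subset_mset.order_trans\<close>)
  then show ?case using add by blast
qed

lemma GL_weaken_left:
  "GL L {#(\<Gamma>, \<Delta>)#} \<Longrightarrow> \<forall>A\<in>#\<Theta>. formula L A \<and> qfree A \<Longrightarrow> GL L {#(\<Theta> + \<Gamma>, \<Delta>)#}"
  by (induction \<Theta>) (auto intro: GL.IW)

text \<open>Each formula on the right is paid for by one \<open>\<bottom>\<close> on the left, by mixing axioms \<open>\<bottom> \<Rightarrow> A\<close>.\<close>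
lemma GL_bots:
  assumes "size \<Delta> \<le> count \<Gamma> Bot" "\<forall>A\<in>#\<Gamma> + \<Delta>. formula L A \<and> qfree A"
  shows "GL L {#(\<Gamma>, \<Delta>)#}"
  using assms
proof (induction \<Delta> arbitrary: \<Gamma>)
  case empty
  then show ?case using GL_weaken_left[OF GL.ax_empty, of \<Gamma> L] by simp
next
  case (add A \<Delta>)
  then have "Bot \<in># \<Gamma>" by (metis add_gr_0 count_greater_zero_iff less_le_trans size_add_mset zero_less_Suc)
  then obtain \<Gamma>' where G: "\<Gamma> = add_mset Bot \<Gamma>'" by (metis insert_DiffM)
  have "GL L {#(\<Gamma>', \<Delta>)#}" using add G by auto
  moreover have "GL L {#({#Bot#}, {#A#})#}" using add.prems by (auto intro: GL.ax_bot)
  ultimately have "GL L {#({#Bot#} + \<Gamma>', {#A#} + \<Delta>)#}" by (rule GL.Mix[rotated])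
  then show ?case using G by simp
qed

definition atomic :: "('f, 'p) fm \<Rightarrow> bool" where
  "atomic A \<longleftrightarrow> A = Bot \<or> (\<exists>P ts. A = Pred P ts)"

lemma pval_atomic: "atomic A \<Longrightarrow> pval v A = (if A = Bot then 1 else v A)"
  by (auto simp: atomic_def)

lemma qfree_atomic: "atomic A \<Longrightarrow> qfree A"
  by (auto simp: atomic_def)

text \<open>Formulas common to both sides cancel by mixing with \<open>A \<Rightarrow> A\<close>. When the sides are disjoint, the
valuation that makes exactly the formulas on the right false shows that there are at least as many
\<open>\<bottom>\<close> on the left as formulas on the right.\<close>
lemma GL_atomic_sequent:
  fixes \<Gamma> \<Delta> :: "('f, 'p) fm multiset"
  assumes "\<forall>A\<in>#\<Gamma> + \<Delta>. formula L A \<and> atomic A"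
    and "\<And>v. unit_valuation v \<Longrightarrow> pval_seq v (\<Gamma>, \<Delta>) \<le> 0"
  shows "GL L {#(\<Gamma>, \<Delta>)#}"
  using assms
proof (induction \<Delta> arbitrary: \<Gamma> rule: measure_induct_rule[of size])
  case (less \<Delta>)
  show ?case
  proof (cases "\<exists>A. A \<in># \<Gamma> \<and> A \<in># \<Delta>")
    case True
    then obtain A \<Gamma>' \<Delta>' where eq: "\<Gamma> = add_mset A \<Gamma>'" "\<Delta> = add_mset A \<Delta>'" by (metis insert_DiffM)
    have "GL L {#(\<Gamma>', \<Delta>')#}"
    proof (rule less.IH)
      fix v :: "('f, 'p) fm \<Rightarrow> real" assume "unit_valuation v"
      from less.prems(2)[OF this] show "pval_seq v (\<Gamma>', \<Delta>') \<le> 0" by (simp add: pval_seq_def eq)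
    qed (use less.prems eq in auto)
    moreover have "GL L {#({#A#}, {#A#})#}"
      using less.prems eq by (auto simp: atomic_def intro!: GL.ax_id)
    ultimately have "GL L {#({#A#} + \<Gamma>', {#A#} + \<Delta>')#}" by (rule GL.Mix[rotated])
    then show ?thesis using eq by simp
  next
    case False
    define v :: "('f, 'p) fm \<Rightarrow> real" where "v A = of_bool (A \<in># \<Delta>)" for A
    have "unit_valuation v" by (simp add: unit_valuation_def v_def)
    note le = less.prems(2)[OF this]
    have at: "atomic A" if "A \<in># \<Gamma> \<or> A \<in># \<Delta>" for A using less.prems(1) that by auto
    have "(\<Sum>A\<in>#\<Delta>. pval v A) = (\<Sum>A\<in>#\<Delta>. 1)"
      by (rule arg_cong[of _ _ sum_mset], rule image_mset_cong) (use at pval_atomic[of _ v] in \<open>auto simp: v_def\<close>)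
    moreover have "(\<Sum>A\<in>#\<Gamma>. pval v A) = (\<Sum>A\<in>#\<Gamma>. of_bool (A = Bot))"
      by (rule arg_cong[of _ _ sum_mset], rule image_mset_cong) (use at False pval_atomic[of _ v] in \<open>auto simp: v_def\<close>)
    moreover have "(\<Sum>A\<in>#\<Gamma>. of_bool (A = Bot)) = real (count \<Gamma> Bot)" for \<Gamma> :: "('f, 'p) fm multiset"
      by (induction \<Gamma>) auto
    ultimately have "real (size \<Delta>) \<le> real (count \<Gamma> Bot)" using le by (simp add: pval_seq_def)
    then show ?thesis using less.prems(1) by (intro GL_bots) (auto simp: qfree_atomic)
  qed
qed

lemma sum_counts:
  "finite V \<Longrightarrow> set_mset M \<subseteq> V \<Longrightarrow> (\<Sum>A\<in>V. real (count M A) * v A) = (\<Sum>A\<in>#M. v A)"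
proof (induction M)
  case (add B M)
  have "(\<Sum>A\<in>V. real (count (add_mset B M) A) * v A) =
      (\<Sum>A\<in>V. real (count M A) * v A + (if A = B then v A else 0))"
    by (rule sum.cong) (auto simp: algebra_simps)
  also have "\<dots> = (\<Sum>A\<in>#add_mset B M. v A)"
    using add by (simp add: sum.distrib)
  finally show ?case .
qed simp

lemma formulas_cone: "S \<in> cone (set_mset H) \<Longrightarrow> formulas_seq S \<subseteq> formulas_hs H"
proof (induction rule: cone.induct)
  case (add S S')
  then show ?case by (auto simp: formulas_seq_def)
qed (auto simp: formulas_hs_def)

text \<open>A sequent is an integer vector \<open>diff S\<close>, with \<open>\<bottom>\<close> as one more unknown to make its value linear.
The vectors in \<open>B\<close> express \<open>0 < v A < v \<bottom>\<close>. A strict solution of all inequalities, scaled to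
\<open>v \<bottom> = 1\<close>, would be a valuation that refutes the hypersequent. So the alternative of \<open>gordan\<close>
holds, and as the vectors in \<open>B\<close> are nonnegative on the unit cube, it yields a sum of sequents whose
value is nowhere positive.\<close>
lemma GL_atomic:
  fixes H :: "('f, 'p) hypersequent"
  assumes lang: "lang_hs L H" and at: "\<And>A. A \<in> formulas_hs H \<Longrightarrow> atomic A"
    and valid: "\<And>v. unit_valuation v \<Longrightarrow> \<exists>S\<in>#H. pval_seq v S \<le> 0"
  shows "GL L H"
proof -
  define V where "V = insert Bot (formulas_hs H)"
  have "finite V" by (simp add: V_def formulas_hs_def formulas_seq_def)
  define diff :: "('f, 'p) sequent \<Rightarrow> ('f, 'p) fm \<Rightarrow> int"
    where "diff S A = int (count (snd S) A) - int (count (fst S) A)" for S A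
  have diff_add: "diff (S + S') = diff S + diff S'" for S S'
    by (auto simp: diff_def fun_eq_iff)
  define e :: "('f, 'p) fm \<Rightarrow> ('f, 'p) fm \<Rightarrow> int" where "e A B = of_bool (B = A)" for A B
  define lin :: "(('f, 'p) fm \<Rightarrow> real) \<Rightarrow> (('f, 'p) fm \<Rightarrow> int) \<Rightarrow> real"
    where "lin v f = (\<Sum>A\<in>V. real_of_int (f A) * v A)" for v f
  have lin_add: "lin v (f + g) = lin v f + lin v g" for v f g
    by (simp add: lin_def algebra_simps sum.distrib)
  have lin_minus: "lin v (f - g) = lin v f - lin v g" for v f g
    by (simp add: lin_def algebra_simps sum_subtractf)
  have lin_0: "lin v 0 = 0" for v by (simp add: lin_def)
  have lin_e: "lin v (e A) = v A" if "A \<in> V" for v A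
  proof -
    have "lin v (e A) = (\<Sum>B\<in>V. if B = A then v B else 0)"
      unfolding lin_def e_def by (rule sum.cong) auto
    then show ?thesis using \<open>finite V\<close> that by simp
  qed
  have lin_diff: "lin v (diff S) = (\<Sum>A\<in>#snd S. v A) - (\<Sum>A\<in>#fst S. v A)"
    if "formulas_seq S \<subseteq> V" for v S
    using that \<open>finite V\<close> 
    by (simp add: lin_def diff_def left_diff_distrib sum_subtractf sum_counts formulas_seq_def)
  define B where "B = insert (e Bot) (\<Union>A\<in>formulas_hs H - {Bot}. {e A, e Bot - e A})"
  have H_V: "formulas_seq S \<subseteq> V" if "S \<in># H" for S
    using that by (auto simp: V_def formulas_hs_def)
  have pval_at: "pval v A = (if A = Bot then 1 else v A)" if "A \<in> V" for v A
    using that at[of A] pval_atomic[of A v] by (auto simp: V_def)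
  have "finite (diff ` set_mset H \<union> B)" by (simp add: B_def formulas_hs_def formulas_seq_def)
  moreover have "f A = 0" if "f \<in> diff ` set_mset H \<union> B" "A \<notin> V" for f A
  proof -
    have "diff S A = 0" if "S \<in># H" for S
    proof -
      have "A \<notin># fst S" "A \<notin># snd S" using H_V[OF that] \<open>A \<notin> V\<close> by (auto simp: formulas_seq_def)
      then have "count (fst S) A = 0" "count (snd S) A = 0" by (simp_all add: count_eq_zero_iff)
      then show ?thesis by (simp add: diff_def)
    qed
    moreover have "e C A = 0" if "C \<in> V" for C using that \<open>A \<notin> V\<close> by (auto simp: e_def)
    ultimately show ?thesis using that by (auto simp: B_def V_def)
  qed
  ultimately have "(\<exists>v. \<forall>f\<in>diff ` set_mset H \<union> B. 0 < lin v f) \<or> (\<lambda>a. 0) \<in> cone (diff ` set_mset H \<union> B)"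
    unfolding lin_def by (intro gordan \<open>finite V\<close>)
  then show ?thesis
  proof (elim disjE exE)
    fix v assume v: "\<forall>f\<in>diff ` set_mset H \<union> B. 0 < lin v f"
    have Bot: "v Bot > 0" using v lin_e[of Bot v] by (auto simp: B_def V_def)
    have box: "0 < v A \<and> v A < v Bot" if "A \<in> formulas_hs H" "A \<noteq> Bot" for A
    proof -
      have "0 < lin v (e A)" "0 < lin v (e Bot - e A)" using v that by (auto simp: B_def)
      then show ?thesis using that by (simp add: lin_minus lin_e V_def)
    qed
    define w where "w A = (if A \<in> V then v A / v Bot else 0)" for A
    have "unit_valuation w"
      using box Bot by (fastforce simp: unit_valuation_def w_def V_def)
    then obtain S where S: "S \<in># H" "pval_seq w S \<le> 0" using valid by blast
    have w: "pval w A = v A / v Bot" if "A \<in> formulas_seq S" for A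
      using that H_V[OF S(1)] pval_at[of A w] Bot by (auto simp: w_def)
    have "pval_seq w S = lin (\<lambda>A. v A / v Bot) (diff S)"
      unfolding lin_diff[OF H_V[OF S(1)]] pval_seq_def using w
      by (intro arg_cong2[of _ _ _ _ "(-)"] arg_cong[of _ _ sum_mset] image_mset_cong) (auto simp: formulas_seq_def)
    also have "\<dots> = lin v (diff S) / v Bot" by (simp add: lin_def sum_divide_distrib)
    also have "\<dots> > 0" using v S(1) Bot by simp
    finally show ?thesis using S(2) by simp
  next
    assume "(\<lambda>a. 0) \<in> cone (diff ` set_mset H \<union> B)"
    then obtain g h where gh: "(\<lambda>a. 0) = g + h" "g \<in> insert 0 (cone (diff ` set_mset H))"
        "h \<in> insert 0 (cone B)" "g \<in> cone (diff ` set_mset H) \<or> h \<in> cone B"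
      by (rule cone_Un)
    have zero: "lin v g + lin v h = 0" for v
      using lin_0[of v] gh(1) by (simp add: lin_add[symmetric] zero_fun_def)
    have cone_pos: "0 < lin v h" if "\<And>f. f \<in> B \<Longrightarrow> 0 < lin v f" "h \<in> cone B" for h v
      using that(2,1) by (induction rule: cone.induct) (auto simp: lin_add add_pos_pos)
    have cone_nonneg: "0 \<le> lin v h" if "\<And>f. f \<in> B \<Longrightarrow> 0 \<le> lin v f" "h \<in> cone B" for h v
      using that(2,1) by (induction rule: cone.induct) (auto simp: lin_add)
    \<comment> \<open>The vectors in \<open>B\<close> alone do not sum to zero: at the centre of the cube they are positive.\<close>
    have "g \<in> cone (diff ` set_mset H)"
    proof (rule ccontr)
      assume "g \<notin> cone (diff ` set_mset H)"
      then have "g = 0" "h \<in> cone B" using gh by auto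
      moreover have "0 < lin (\<lambda>A. if A = Bot then 1 else 1/2) f" if "f \<in> B" for f
        using that by (auto simp: B_def lin_minus lin_e V_def split: if_splits)
      ultimately show False using cone_pos zero lin_0 by (metis add_0 less_irrefl)
    qed
    then obtain S where S: "S \<in> cone (set_mset H)" "g = diff S"
      using cone_image[of diff, OF diff_add] by blast
    have SH: "formulas_seq S \<subseteq> formulas_hs H" using formulas_cone[OF S(1)] .
    have "GL L {#(fst S, snd S)#}"
    proof (rule GL_atomic_sequent)
      show "\<forall>A\<in>#fst S + snd S. formula L A \<and> atomic A"
        using SH at lang by (auto simp: formulas_seq_def lang_hs_def)
      fix v :: "('f, 'p) fm \<Rightarrow> real" assume v: "unit_valuation v"
      have "0 \<le> lin (pval v) f" if "f \<in> B" for f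
        using that v pval_at[of _ v] by (auto simp: B_def lin_minus lin_e V_def unit_valuation_def split: if_splits)
      then have "0 \<le> lin (pval v) h" using gh(3) cone_nonneg by (auto simp: lin_0)
      then have "lin (pval v) (diff S) \<le> 0" using zero[of "pval v"] S(2) by simp
      then show "pval_seq v (fst S, snd S) \<le> 0"
        using lin_diff[of S "pval v"] SH by (simp add: pval_seq_def V_def subset_insertI2)
    qed
    then have "GL L {#S#}" by simp
    moreover have "propositional_hs H"
      using at by (auto simp: propositional_hs_def qfree_atomic)
    ultimately have "GL L (add_mset S H)" using GL_weaken lang by fastforce
    then show ?thesis using GL_cone[OF S(1)] by blast
  qed
qed

fun implications :: "('f, 'p) fm \<Rightarrow> nat" where
  "implications (Imp A B) = Suc (implications A + implications B)"
| "implications _ = 0"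

definition complexity :: "('f, 'p) sequent \<Rightarrow> nat" where
  "complexity S = (\<Sum>A\<in>#fst S. implications A) + (\<Sum>A\<in>#snd S. implications A)"

text \<open>Read upwards, both implication rules preserve validity and replace a sequent by at most two sequents
with fewer implications. The weight \<open>3 ^ c\<close> of a sequent with \<open>c\<close> implications decreases even when
there are two, since \<open>3 ^ c + 3 ^ c < 3 ^ (c + 1)\<close>.\<close>
theorem GL_complete:
  fixes H :: "('f, 'p) hypersequent"
  assumes "lang_hs L H" "propositional_hs H"
    and "\<And>v. unit_valuation v \<Longrightarrow> \<exists>S\<in>#H. pval_seq v S \<le> 0"
  shows "GL L H"
  using assms
proof (induction H rule: measure_induct_rule[where f = "\<lambda>H :: ('f, 'p) hypersequent. \<Sum>S\<in>#H. (3::nat) ^ complexity S"])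
  case (less H)
  note simps = lang_hs_def propositional_hs_def formulas_hs_def formulas_seq_def
  have pow: "(3::nat) ^ a + 3 ^ b < 3 ^ c" if "a < c" "b < c" for a b c :: nat
  proof -
    from that obtain d where c: "c = Suc d" "a \<le> d" "b \<le> d" by (cases c, auto)
    then have "(3::nat) ^ a \<le> 3 ^ d" "(3::nat) ^ b \<le> 3 ^ d" "(0::nat) < 3 ^ d" by simp_all
    then show ?thesis unfolding c(1) power_Suc by linarith
  qed
  show ?case
  proof (cases "\<exists>S A B. S \<in># H \<and> (Imp A B \<in># fst S \<or> Imp A B \<in># snd S)")
    case False
    have "atomic A" if "A \<in> formulas_hs H" for A
    proof -
      have "qfree A" using that less.prems(2) by (auto simp: propositional_hs_def)
      moreover have "A \<noteq> Imp B C" for B C using that False by (auto simp: formulas_hs_def formulas_seq_def)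
      ultimately show ?thesis by (cases A) (auto simp: atomic_def)
    qed
    then show ?thesis using less.prems by (intro GL_atomic)
  next
    case True
    then obtain S A B where S: "S \<in># H" "Imp A B \<in># fst S \<or> Imp A B \<in># snd S" by blast
    then obtain G where H: "H = add_mset S G" by (metis insert_DiffM)
    have "Imp A B \<in> formulas_hs H" using S by (auto simp: formulas_hs_def formulas_seq_def)
    then have form: "formula L (Imp A B)" "qfree (Imp A B)"
      using less.prems(1,2) unfolding lang_hs_def propositional_hs_def by blast+
    then have AB: "formula L A" "formula L B" "qfree A" "qfree B" by (auto elim: formula_ImpE)
    from S(2) show ?thesis
    proof
      assume "Imp A B \<in># fst S"
      then obtain \<Gamma> \<Delta> where SG: "S = (add_mset (Imp A B) \<Gamma>, \<Delta>)" by (metis insert_DiffM prod.collapse)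
      let ?H = "add_mset (\<Gamma>, \<Delta>) (add_mset (add_mset B \<Gamma>, add_mset A \<Delta>) G)"
      have "GL L ?H"
      proof (rule less.IH)
        show "(\<Sum>S\<in>#?H. (3::nat) ^ complexity S) < (\<Sum>S\<in>#H. (3::nat) ^ complexity S)"
          using pow[of "complexity (\<Gamma>, \<Delta>)" "complexity S" "complexity (add_mset B \<Gamma>, add_mset A \<Delta>)"]
          by (simp add: H SG complexity_def)
        show "lang_hs L ?H" "propositional_hs ?H"
          using less.prems(1,2) AB by (auto simp: simps H SG)
        fix v :: "('f, 'p) fm \<Rightarrow> real" assume "unit_valuation v"
        with less.prems(3) obtain S' where "S' \<in># H" "pval_seq v S' \<le> 0" by blast
        then show "\<exists>S\<in>#?H. pval_seq v S \<le> 0"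
          by (auto simp: H SG pval_seq_def max_def split: if_splits)
      qed
      then show ?thesis unfolding H SG by (rule GL.Imp_left)
    next
      assume "Imp A B \<in># snd S"
      then obtain \<Gamma> \<Delta> where SG: "S = (\<Gamma>, add_mset (Imp A B) \<Delta>)" by (metis insert_DiffM prod.collapse)
      have "GL L (add_mset S' G)" if S': "S' = (\<Gamma>, \<Delta>) \<or> S' = (add_mset A \<Gamma>, add_mset B \<Delta>)" for S'
      proof (rule less.IH)
        have "complexity S' < complexity S" using S' by (auto simp: SG complexity_def)
        then show "(\<Sum>S\<in>#add_mset S' G. (3::nat) ^ complexity S) < (\<Sum>S\<in>#H. (3::nat) ^ complexity S)"
          by (simp add: H)
        show "lang_hs L (add_mset S' G)" "propositional_hs (add_mset S' G)"
          using less.prems(1,2) AB S' by (auto simp: simps H SG)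
        fix v :: "('f, 'p) fm \<Rightarrow> real" assume "unit_valuation v"
        with less.prems(3) obtain S'' where "S'' \<in># H" "pval_seq v S'' \<le> 0" by blast
        moreover have "pval_seq v S' \<le> pval_seq v S" using S' by (auto simp: SG pval_seq_def)
        ultimately show "\<exists>S\<in>#add_mset S' G. pval_seq v S \<le> 0"
          by (auto simp: H)
      qed
      then show ?thesis unfolding H SG by (intro GL.Imp_right) auto
    qed
  qed
qed

section \<open>Consistent sets of sequents\<close>

text \<open>The property to be shown of \<open>G\<close> joined with finitely many sequents \<open>m C \<Rightarrow> \<bottom>\<close>. Derivability in \<open>GL\<close>
already makes \<open>H0\<close> a propositional hypersequent of the language (\<open>GL_language\<close>).\<close>
definition provable :: "('f, 'p) lang \<Rightarrow> nat \<Rightarrow> ('f, 'p) hypersequent \<Rightarrow> bool" where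
  "provable L n H \<longleftrightarrow> (\<exists>H0. GL L H0 \<and> quant_derivable L n H0 (approx_hs n H))"

lemma approx_hs_simps [simp]:
  "approx_hs n {#} = {#}"
  "approx_hs n (add_mset S H) = add_mset (approx_seq n S) (approx_hs n H)"
  "approx_hs n (H + H') = approx_hs n H + approx_hs n H'"
  by (simp_all add: approx_hs_def)

lemma GL_nonempty: "GL L H \<Longrightarrow> H \<noteq> {#}"
  by (induction rule: GL.induct) auto

lemma quant_derivable_nonempty: "quant_derivable L n H H' \<Longrightarrow> H \<noteq> {#} \<Longrightarrow> H' \<noteq> {#}"
  by (induction rule: quant_derivable.induct) auto

lemma provable_nonempty: "provable L n H \<Longrightarrow> H \<noteq> {#}"
  unfolding provable_def using GL_nonempty quant_derivable_nonempty by fastforce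

lemma formulas_approx: "formulas_seq (approx_seq n S) \<subseteq> insert Bot (formulas_seq S)"
  by (auto simp: formulas_seq_def approx_seq_def simp flip: count_greater_zero_iff)

lemma vars_approx: "vars_hs (approx_hs n H) \<subseteq> vars_hs H"
  using formulas_approx by (fastforce simp: vars_hs_def formulas_hs_def approx_hs_def)

lemma provable_EW:
  assumes "provable L n H" "\<forall>A\<in>formulas_seq S. formula L A"
  shows "provable L n (add_mset S H)"
proof -
  have "\<forall>A\<in>formulas_seq (approx_seq n S). formula L A"
    using assms(2) formulas_approx formula.intros(1) by blast
  moreover have "approx_hs n H \<noteq> {#}"
    using provable_nonempty[OF assms(1)] by (simp add: approx_hs_def)
  ultimately show ?thesis
    using assms(1) by (auto simp: provable_def intro: quant_derivable.EW)
qed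

lemma provable_EC: "provable L n (add_mset S (add_mset S H)) \<Longrightarrow> provable L n (add_mset S H)"
  by (auto simp: provable_def intro: quant_derivable.EC)

text \<open>Weaken to \<open>H' + H\<close> and contract \<open>H\<close> away: only the set of sequents matters.\<close>
lemma provable_mono:
  assumes "provable L n H" "set_mset H \<subseteq> set_mset H'" "lang_hs L H'"
  shows "provable L n H'"
proof -
  have "provable L n (H' + H)"
    using assms(3)
  proof (induction H')
    case empty then show ?case using assms(1) by simp
  next
    case (add S H')
    then show ?case by (auto simp: lang_hs_def formulas_hs_def intro!: provable_EW)
  qed
  then show ?thesis using assms(2)
  proof (induction H)
    case (add S H)
    then obtain H'' where "H' = add_mset S H''" by (metis insert_DiffM insert_subset set_mset_add_mset_insert)
    then have "provable L n (H' + H)" using add.prems(1) provable_EC[of L n S "H'' + H"] by simp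
    then show ?case using add by simp
  qed simp
qed

text \<open>The quantifier rules read from conclusion to premise, without the side hypersequent: the
first relation collects the rules that use an arbitrary term, the second those with an
eigenvariable.\<close>
inductive instance_step :: "('f, 'p) lang \<Rightarrow> ('f, 'p) sequent \<Rightarrow> ('f, 'p) sequent \<Rightarrow> bool" for L where
  "formula L (All x A) \<Longrightarrow> lterm L t \<Longrightarrow>
   instance_step L (add_mset (All x A) \<Gamma>, \<Delta>) (add_mset (subst (Bv x) t A) \<Gamma>, \<Delta>)"
| "formula L (Ex x A) \<Longrightarrow> lterm L t \<Longrightarrow>
   instance_step L (\<Gamma>, add_mset (Ex x A) \<Delta>) (\<Gamma>, add_mset (subst (Bv x) t A) \<Delta>)"

inductive witness_step :: "('f, 'p) lang \<Rightarrow> nat \<Rightarrow> ('f, 'p) sequent \<Rightarrow> ('f, 'p) sequent \<Rightarrow> bool" for L a where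
  "formula L (All x A) \<Longrightarrow>
   witness_step L a (\<Gamma>, add_mset (All x A) \<Delta>) (\<Gamma>, add_mset (subst (Bv x) (Var (Fv a)) A) \<Delta>)"
| "formula L (Ex x A) \<Longrightarrow>
   witness_step L a (add_mset (Ex x A) \<Gamma>, \<Delta>) (add_mset (subst (Bv x) (Var (Fv a)) A) \<Gamma>, \<Delta>)"

lemma provable_instance:
  assumes "instance_step L S S'" "provable L n (add_mset S' H)"
  shows "provable L n (add_mset S H)"
  using assms by (cases rule: instance_step.cases)
    (auto simp: provable_def intro: quant_derivable.All_left quant_derivable.Ex_right)

lemma provable_witness:
  assumes "witness_step L a S S'" "Fv a \<notin> vars_hs (add_mset S H)" "provable L n (add_mset S' H)"
  shows "provable L n (add_mset S H)"
proof -
  have fresh: "Fv a \<notin> vars_hs (add_mset (approx_seq n S) (approx_hs n H))"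
    using assms(2) vars_approx[of n "add_mset S H"] by auto
  show ?thesis
    using assms(1,3) fresh by (cases rule: witness_step.cases)
      (auto simp: provable_def intro: quant_derivable.All_right quant_derivable.Ex_left)
qed

definition prenex_sequents :: "('f, 'p) lang \<Rightarrow> ('f, 'p) sequent set" where
  "prenex_sequents L = {S. \<forall>A\<in>formulas_seq S. formula L A \<and> prenex A}"

lemma prenex_All [simp]: "prenex (All x A) \<longleftrightarrow> prenex A"
  by (auto intro: prenex.intros elim: prenex.cases)

lemma prenex_Ex [simp]: "prenex (Ex x A) \<longleftrightarrow> prenex A"
  by (auto intro: prenex.intros elim: prenex.cases)

lemma instance_step_prenex:
  "instance_step L S S' \<Longrightarrow> S \<in> prenex_sequents L \<Longrightarrow> S' \<in> prenex_sequents L"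
  by (cases rule: instance_step.cases)
    (auto simp: prenex_sequents_def formulas_seq_def prenex_subst formula_All_instance formula_Ex_instance)

lemma witness_step_prenex:
  "witness_step L a S S' \<Longrightarrow> S \<in> prenex_sequents L \<Longrightarrow> S' \<in> prenex_sequents L"
  by (cases rule: witness_step.cases)
    (auto simp: prenex_sequents_def formulas_seq_def prenex_subst formula_All_instance formula_Ex_instance lterm.intros)

lemma witness_step_any: "witness_step L a S S' \<Longrightarrow> \<exists>S''. witness_step L b S S''"
  by (cases rule: witness_step.cases) (auto intro: witness_step.intros)

lemma countable_prenex_sequents: "countable_lang L \<Longrightarrow> countable (prenex_sequents L)"
proof -
  assume "countable_lang L"
  then have "countable {M. set_mset M \<subseteq> {A. formula L A}}"
    by (intro countable_multisets countable_formulas)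
  then have "countable ({M. set_mset M \<subseteq> {A. formula L A}} \<times> {M. set_mset M \<subseteq> {A. formula L A}})"
    by simp
  moreover have "prenex_sequents L \<subseteq> {M. set_mset M \<subseteq> {A. formula L A}} \<times> {M. set_mset M \<subseteq> {A. formula L A}}"
    by (auto simp: prenex_sequents_def formulas_seq_def)
  ultimately show ?thesis using countable_subset by blast
qed

definition consistent :: "('f, 'p) lang \<Rightarrow> nat \<Rightarrow> ('f, 'p) sequent set \<Rightarrow> bool" where
  "consistent L n X \<longleftrightarrow> (\<forall>H. set_mset H \<subseteq> X \<longrightarrow> \<not> provable L n H)"

lemma consistent_subset: "consistent L n X \<Longrightarrow> Y \<subseteq> X \<Longrightarrow> consistent L n Y"
  by (auto simp: consistent_def)

text \<open>A proof that uses the new sequent \<open>S'\<close> can be brought into a form where it uses it once, as premise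
of the step that leads back to \<open>S\<close>. In particular the eigenvariable condition only has to be met for
side sequents from \<open>X\<close>.\<close>
lemma consistent_insert:
  assumes X: "consistent L n X" "X \<subseteq> prenex_sequents L" and S: "S \<in> X" "S' \<in> prenex_sequents L"
    and step: "\<And>H. set_mset H \<subseteq> X \<Longrightarrow> provable L n (add_mset S' H) \<Longrightarrow> provable L n (add_mset S H)"
  shows "consistent L n (insert S' X)"
  unfolding consistent_def
proof (intro allI impI notI)
  fix H assume H: "set_mset H \<subseteq> insert S' X" "provable L n H"
  let ?H = "filter_mset (\<lambda>S. S \<noteq> S') H"
  have sub: "set_mset ?H \<subseteq> X" using H(1) by auto
  have "lang_hs L (add_mset S' ?H)"
    using sub X(2) S(2) by (auto simp: lang_hs_def formulas_hs_def prenex_sequents_def)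
  then have "provable L n (add_mset S' ?H)"
    by (intro provable_mono[OF H(2)]) auto
  then have "provable L n (add_mset S ?H)" using step sub by blast
  then show False using X(1) S(1) sub by (auto simp: consistent_def)
qed

definition fresh_vars :: "('f, 'p) sequent set \<Rightarrow> nat set" where
  "fresh_vars X = {a. \<forall>S\<in>X. \<forall>A\<in>formulas_seq S. Fv a \<notin> vars_fm A}"

lemma infinite_fresh_insert: "infinite (fresh_vars X) \<Longrightarrow> infinite (fresh_vars (insert S X))"
proof -
  assume inf: "infinite (fresh_vars X)"
  have "finite (\<Union>A\<in>formulas_seq S. Fv -` vars_fm A)"
    by (intro finite_UN_I finite_vimageI) (auto simp: inj_def formulas_seq_def)
  then have "infinite (fresh_vars X - (\<Union>A\<in>formulas_seq S. Fv -` vars_fm A))"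
    using inf by (rule Diff_infinite_finite)
  moreover have "fresh_vars X - (\<Union>A\<in>formulas_seq S. Fv -` vars_fm A) \<subseteq> fresh_vars (insert S X)"
    by (auto simp: fresh_vars_def)
  ultimately show ?thesis using infinite_super by blast
qed

text \<open>Every prenex sequent of the language is visited at some stage. A visited sequent is added if this is consistent, and then a witness
is added along with it, whose variable is fresh for everything collected so far; infinitely many
variables stay fresh since each step adds at most two sequents. In the limit every sequent that can
be added consistently is present, and this includes all instances. A sequent may offer several
eigenvariable steps; one of them is enough for the truth lemma.\<close>
lemma henkin_extension:
  fixes X0 :: "('f, 'p) sequent set"
  assumes count: "countable_lang L" and X0: "consistent L n X0" "X0 \<subseteq> prenex_sequents L"
    and fresh: "infinite (fresh_vars X0)"
  shows "\<exists>X. X0 \<subseteq> X \<and> X \<subseteq> prenex_sequents L \<and> consistent L n X \<and>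
    (\<forall>S\<in>X. \<forall>S'. instance_step L S S' \<longrightarrow> S' \<in> X) \<and>
    (\<forall>S\<in>X. \<forall>a S'. witness_step L a S S' \<longrightarrow> (\<exists>b. \<exists>S''\<in>X. witness_step L b S S''))"
proof -
  define e where "e = from_nat_into (prenex_sequents L)"
  have "({#}, {#}) \<in> prenex_sequents L" by (simp add: prenex_sequents_def formulas_seq_def)
  then have ne: "prenex_sequents L \<noteq> {}" by blast
  have e: "e k \<in> prenex_sequents L" for k unfolding e_def by (rule from_nat_into[OF ne])
  have surj: "\<exists>k. e k = S" if "S \<in> prenex_sequents L" for S
    using from_nat_into_surj[OF countable_prenex_sequents[OF count] that] by (auto simp: e_def)
  let ?P = "\<lambda>k X. consistent L n X \<and> X \<subseteq> prenex_sequents L \<and> X0 \<subseteq> X \<and> infinite (fresh_vars X)"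
  let ?Q = "\<lambda>k X Y. X \<subseteq> Y \<and> (consistent L n (insert (e k) X) \<longrightarrow> e k \<in> Y \<and>
      (\<forall>a S'. witness_step L a (e k) S' \<longrightarrow> (\<exists>b. \<exists>S''\<in>Y. witness_step L b (e k) S'')))"
  have "\<exists>f. \<forall>k. ?P k (f k) \<and> ?Q k (f k) (f (Suc k))"
  proof (rule dependent_nat_choice)
    show "\<exists>X. ?P 0 X" using X0 fresh by blast
  next
    fix X k assume X: "?P k X"
    show "\<exists>Y. ?P (Suc k) Y \<and> ?Q k X Y"
    proof (cases "consistent L n (insert (e k) X)")
      case False
      then show ?thesis using X by blast
    next
      case True
      let ?X = "insert (e k) X"
      have X': "?P (Suc k) ?X" using X True e infinite_fresh_insert[of X "e k"] by auto
      show ?thesis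
      proof (cases "\<exists>a S'. witness_step L a (e k) S'")
        case False
        then show ?thesis using X' by (intro exI[of _ ?X]) auto
      next
        case True
        then obtain a0 S0 where "witness_step L a0 (e k) S0" by blast
        obtain a where a: "a \<in> fresh_vars ?X" using X' infinite_imp_nonempty by blast
        obtain S' where S': "witness_step L a (e k) S'"
          using witness_step_any \<open>witness_step L a0 (e k) S0\<close> by blast
        have "consistent L n (insert S' ?X)"
        proof (rule consistent_insert[where S = "e k"])
          show "S' \<in> prenex_sequents L" using witness_step_prenex[OF S' e] .
          fix H assume "set_mset H \<subseteq> ?X" "provable L n (add_mset S' H)"
          moreover have "Fv a \<notin> vars_hs (add_mset (e k) H)"
            using a \<open>set_mset H \<subseteq> ?X\<close> by (fastforce simp: vars_hs_def formulas_hs_def fresh_vars_def)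
          ultimately show "provable L n (add_mset (e k) H)" using provable_witness[OF S'] by blast
        qed (use X' in auto)
        then have "?P (Suc k) (insert S' ?X)"
          using X' witness_step_prenex[OF S' e] infinite_fresh_insert[of ?X S'] by auto
        moreover have "\<exists>b. \<exists>S''\<in>insert S' ?X. witness_step L b (e k) S''" using S' by auto
        ultimately show ?thesis by (intro exI[of _ "insert S' ?X"]) (simp add: subset_insertI2 subset_insertI)
      qed
    qed
  qed
  then obtain f where f: "\<And>k. ?P k (f k)" "\<And>k. ?Q k (f k) (f (Suc k))" by blast
  define X where "X = (\<Union>k. f k)"
  have "incseq f" by (rule incseq_SucI) (use f(2) in blast)
  \<comment> \<open>Consistency has finite character, so it passes to the union of the chain.\<close>
  have fin: "\<exists>k. set_mset H \<subseteq> f k" if "set_mset H \<subseteq> X" for H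
    using that
  proof (induction H)
    case (add S H)
    then obtain i j where "set_mset H \<subseteq> f i" "S \<in> f j" by (auto simp: X_def)
    then have "set_mset (add_mset S H) \<subseteq> f (max i j)"
      using incseqD[OF \<open>incseq f\<close>, of i "max i j"] incseqD[OF \<open>incseq f\<close>, of j "max i j"] by auto
    then show ?case by blast
  qed simp
  have cons: "consistent L n X"
    unfolding consistent_def
  proof (intro allI impI)
    fix H assume "set_mset H \<subseteq> X"
    then obtain k where "set_mset H \<subseteq> f k" using fin by blast
    then show "\<not> provable L n H" using f(1)[of k] by (simp add: consistent_def)
  qed
  have prenex: "X \<subseteq> prenex_sequents L" using f(1) by (auto simp: X_def)
  have added: "S \<in> X \<and> (\<forall>a S'. witness_step L a S S' \<longrightarrow> (\<exists>b. \<exists>S''\<in>X. witness_step L b S S''))"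
    if S: "S \<in> prenex_sequents L" "consistent L n (insert S X)" for S
  proof -
    obtain k where k: "e k = S" using surj S(1) by blast
    have "consistent L n (insert (e k) (f k))"
      by (rule consistent_subset[OF S(2)]) (auto simp: k X_def)
    then show ?thesis using f(2)[of k] unfolding k X_def by blast
  qed
  show ?thesis
  proof (intro exI[of _ X] conjI ballI allI impI)
    show "X0 \<subseteq> X" using f(1) by (auto simp: X_def)
    show "S' \<in> X" if S: "S \<in> X" "instance_step L S S'" for S S'
    proof -
      have S': "S' \<in> prenex_sequents L" using instance_step_prenex[OF S(2)] S(1) prenex by blast
      have "consistent L n (insert S' X)"
        using provable_instance[OF S(2)] by (intro consistent_insert[OF cons prenex S(1) S'])
      then show ?thesis using added S' by blast
    qed
    show "\<exists>b. \<exists>S''\<in>X. witness_step L b S S''" if "S \<in> X" "witness_step L a S S'" for S S' a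
    proof -
      have "S \<in> prenex_sequents L" "consistent L n (insert S X)"
        using that(1) prenex cons by (auto simp: insert_absorb)
      then show ?thesis using added that(2) by blast
    qed
  qed (use prenex cons in auto)
qed

section \<open>Compactness\<close>

lemma continuous_pval: "continuous_on UNIV (\<lambda>v. pval v A)"
  by (induction A) (auto intro!: continuous_intros)

lemma continuous_pval_seq: "continuous_on UNIV (\<lambda>v. pval_seq v S)"
proof -
  have "continuous_on UNIV (\<lambda>v. \<Sum>A\<in>#M. pval v A)" for M :: "('a, 'b) fm multiset"
    by (induction M) (auto intro!: continuous_intros continuous_pval)
  then show ?thesis unfolding pval_seq_def by (intro continuous_intros)
qed

lemma compact_unit_valuations: "compact {v :: 'a \<Rightarrow> real. unit_valuation v}"
proof -
  have "compactin (product_topology (\<lambda>i::'a. euclideanreal) UNIV) (PiE UNIV (\<lambda>i. {0..1}))"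
    by (subst compactin_PiE) auto
  moreover have "PiE UNIV (\<lambda>i. {0..1}) = {v :: 'a \<Rightarrow> real. unit_valuation v}"
    by (auto simp: unit_valuation_def PiE_iff)
  ultimately show ?thesis by (simp add: euclidean_product_topology)
qed

text \<open>The weak bound \<open>c \<le> \<dots>\<close> defines closed sets in the cube, which is compact by Tychonoff's theorem.\<close>
lemma valuation_compactness:
  assumes "\<And>F. finite F \<Longrightarrow> F \<subseteq> Q \<Longrightarrow> \<exists>v. unit_valuation v \<and> (\<forall>S\<in>F. c \<le> pval_seq v S)"
  shows "\<exists>v. unit_valuation v \<and> (\<forall>S\<in>Q. c \<le> pval_seq v S)"
proof -
  have "{v. unit_valuation v} \<inter> (\<Inter>S\<in>Q. {v. c \<le> pval_seq v S}) \<noteq> {}"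
  proof (rule compact_imp_fip_image[OF compact_unit_valuations])
    show "closed {v. c \<le> pval_seq v S}" for S
      by (intro closed_Collect_le continuous_on_const continuous_pval_seq)
    show "{v. unit_valuation v} \<inter> (\<Inter>S\<in>F. {v. c \<le> pval_seq v S}) \<noteq> {}" if "finite F" "F \<subseteq> Q" for F
      using assms[OF that] by blast
  qed
  then show ?thesis by blast
qed

section \<open>Term models\<close>

text \<open>The universe has to lie in a prescribed type, so terms enter through an injective coding \<open>e\<close>. A
symbol is interpreted by decoding its arguments and forming the term or the atomic formula.\<close>
definition term_struct ::
    "('f, 'p) lang \<Rightarrow> ('f tm \<Rightarrow> 'm) \<Rightarrow> (('f, 'p) fm \<Rightarrow> real) \<Rightarrow> ('f, 'p, 'm) struct" where
  "term_struct L e v = \<lparr>univ = e ` {t. lterm L t},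
     fint = (\<lambda>f ms. e (Fn f (map (inv_into {t. lterm L t} e) ms))),
     pint = (\<lambda>P ms. v (Pred P (map (inv_into {t. lterm L t} e) ms)))\<rparr>"

lemma val_lterm:
  assumes "inj_on e {t. lterm L t}" "\<And>a. \<beta> (Fv a) = e (Var (Fv a))" "lterm L t"
  shows "val_tm (term_struct L e v) \<beta> t = e t"
  using assms(3)
proof (induction rule: lterm.induct)
  case (2 f ts)
  have "map (inv_into {t. lterm L t} e \<circ> val_tm (term_struct L e v) \<beta>) ts = ts"
    using 2 assms(1) by (intro map_idI) simp
  then show ?case by (simp add: term_struct_def)
qed (simp add: assms)

lemma val_qfree:
  assumes "inj_on e {t. lterm L t}" "\<And>a. \<beta> (Fv a) = e (Var (Fv a))" "formula L A" "qfree A"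
  shows "val_fm (term_struct L e v) \<beta> A = pval v A"
  using assms(3,4)
proof (induction rule: formula.induct)
  case (2 P ts)
  have "map (inv_into {t. lterm L t} e \<circ> val_tm (term_struct L e v) \<beta>) ts = ts"
    using 2 assms(1) val_lterm[OF assms(1,2)] by (intro map_idI) simp
  then show ?case by (simp add: term_struct_def)
qed auto

lemma val_fm_bounds:
  assumes "\<And>P ms. 0 \<le> pint M P ms \<and> pint M P ms \<le> 1" "univ M \<noteq> {}"
  shows "0 \<le> val_fm M \<beta> A \<and> val_fm M \<beta> A \<le> 1"
proof (induction A arbitrary: \<beta>)
  case (Imp A B)
  from Imp.IH(1)[of \<beta>] Imp.IH(2)[of \<beta>] show ?case by (simp add: max_def)
next
  case (All x A)
  obtain m where m: "m \<in> univ M" using assms(2) by blast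
  have "bdd_above ((\<lambda>m. val_fm M (\<beta>(Bv x := m)) A) ` univ M)" using All by (intro bdd_aboveI2[of _ _ 1]) auto
  then have "0 \<le> (SUP m\<in>univ M. val_fm M (\<beta>(Bv x := m)) A)"
    using cSUP_upper2[OF _ m, of "\<lambda>m. val_fm M (\<beta>(Bv x := m)) A" 0] All by auto
  then show ?case using All assms(2) by (auto intro!: cSUP_least)
next
  case (Ex x A)
  obtain m where m: "m \<in> univ M" using assms(2) by blast
  have "bdd_below ((\<lambda>m. val_fm M (\<beta>(Bv x := m)) A) ` univ M)" using Ex by (intro bdd_belowI2[of _ 0]) auto
  then have "(INF m\<in>univ M. val_fm M (\<beta>(Bv x := m)) A) \<le> 1"
    using cINF_lower2[OF _ m, of "\<lambda>m. val_fm M (\<beta>(Bv x := m)) A" 1] Ex by auto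
  then show ?case using Ex assms(2) by (auto intro!: cINF_greatest)
qed (use assms in auto)

lemma val_tm_cong: "(\<And>w. w \<in> vars_tm t \<Longrightarrow> \<beta> w = \<gamma> w) \<Longrightarrow> val_tm M \<beta> t = val_tm M \<gamma> t"
proof (induction t)
  case (Fn f ts)
  then have "map (val_tm M \<beta>) ts = map (val_tm M \<gamma>) ts" by auto
  then show ?case by (metis val_tm.simps(2))
qed simp

lemma val_fm_subst:
  assumes "\<And>y. Bv y \<notin> vars_tm t"
  shows "val_fm M \<beta> (subst (Bv x) t A) = val_fm M (\<beta>(Bv x := val_tm M \<beta> t)) A"
proof -
  have tm: "val_tm M \<beta> (subst_tm (Bv x) t s) = val_tm M (\<beta>(Bv x := val_tm M \<beta> t)) s" for \<beta> s
    by (induction s) (simp_all cong: map_cong add: comp_def)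
  have upd: "val_tm M (\<beta>(Bv y := m)) t = val_tm M \<beta> t" for \<beta> y m
    using assms by (intro val_tm_cong) auto
  show ?thesis
  proof (induction A arbitrary: \<beta>)
    case (All y A)
    show ?case by (cases "y = x") (simp_all add: All upd fun_upd_twist del: fun_upd_apply)
  next
    case (Ex y A)
    show ?case by (cases "y = x") (simp_all add: Ex upd fun_upd_twist del: fun_upd_apply)
  qed (simp_all add: tm comp_def)
qed

lemma interpretation_term_struct:
  assumes "inj_on e {t. lterm L t}" "unit_valuation v" "\<And>w. \<beta> w \<in> e ` {t. lterm L t}"
  shows "is_interpretation L (term_struct L e v) \<beta>"
proof -
  have "e (Fn f (map (inv_into {t. lterm L t} e) ms)) \<in> e ` {t. lterm L t}"
    if "f \<in> funs L" "ms \<in> lists (e ` {t. lterm L t})" "length ms = farity L f" for f ms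
  proof -
    have "\<forall>m\<in>set ms. lterm L (inv_into {t. lterm L t} e m)"
      using that(2) inv_into_into[of _ e "{t. lterm L t}"] by auto
    then show ?thesis using that by (intro imageI) (auto intro!: lterm.intros)
  qed
  then show ?thesis using assms
    by (auto simp: is_interpretation_def term_struct_def unit_valuation_def intro: lterm.intros)
qed

text \<open>Induction on the number of quantifiers. For a universal formula on the left, all instances are
available, and \<open>c\<close> bounds the value for each term, hence also for the supremum. For a universal
formula on the right, a single instance suffices, as the supremum is at least its value. The
existential cases are dual.\<close>
lemma truth_lemma:
  fixes L :: "('f, 'p) lang" and e :: "'f tm \<Rightarrow> 'm"
  assumes e: "inj_on e {t. lterm L t}" and v: "unit_valuation v"
    and \<beta>: "\<And>a. \<beta> (Fv a) = e (Var (Fv a))"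
    and prenex: "X \<subseteq> prenex_sequents L"
    and inst: "\<And>S S'. S \<in> X \<Longrightarrow> instance_step L S S' \<Longrightarrow> S' \<in> X"
    and wit: "\<And>S S' a. S \<in> X \<Longrightarrow> witness_step L a S S' \<Longrightarrow> \<exists>b. \<exists>S''\<in>X. witness_step L b S S''"
    and qfree: "\<And>S. S \<in> X \<Longrightarrow> \<forall>A\<in>formulas_seq S. qfree A \<Longrightarrow> c \<le> pval_seq v S"
    and "S \<in> X"
  shows "c \<le> val_seq (term_struct L e v) \<beta> S"
  using \<open>S \<in> X\<close>
proof (induction S rule: measure_induct_rule[where
      f = "\<lambda>S. (\<Sum>A\<in>#fst S. quantifiers A) + (\<Sum>A\<in>#snd S. quantifiers A)"])
  case (less S)
  let ?M = "term_struct L e v"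
  let ?q = "\<lambda>S :: ('f, 'p) sequent. (\<Sum>A\<in>#fst S. quantifiers A) + (\<Sum>A\<in>#snd S. quantifiers A)"
  have univ: "univ ?M = e ` {t. lterm L t}" by (simp add: term_struct_def)
  have "univ ?M \<noteq> {}" unfolding univ by (auto intro: lterm.intros)
  moreover have "0 \<le> pint ?M P ms \<and> pint ?M P ms \<le> 1" for P ms
    using v by (simp add: term_struct_def unit_valuation_def)
  ultimately have bounds: "0 \<le> val_fm ?M \<gamma> A \<and> val_fm ?M \<gamma> A \<le> 1" for \<gamma> A
    using val_fm_bounds by blast
  have bdd: "bdd_above ((\<lambda>m. val_fm ?M (\<beta>(Bv x := m)) A) ` univ ?M)"
    "bdd_below ((\<lambda>m. val_fm ?M (\<beta>(Bv x := m)) A) ` univ ?M)" for x A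
    using bounds by (auto intro!: bdd_aboveI2[of _ _ 1] bdd_belowI2[of _ 0])
  have val_inst: "val_fm ?M \<beta> (subst (Bv x) t A) = val_fm ?M (\<beta>(Bv x := e t)) A" if "lterm L t" for x t A
    using val_fm_subst[of t ?M \<beta> x A] lterm_Bv[OF that] val_lterm[OF e \<beta> that] by simp
  have form: "formula L A" "prenex A" if "A \<in># fst S \<or> A \<in># snd S" for A
    using that less.prems prenex by (auto simp: prenex_sequents_def formulas_seq_def)
  consider "\<forall>A\<in>formulas_seq S. qfree A"
    | x A where "All x A \<in># fst S" | x A where "Ex x A \<in># snd S"
    | x A where "All x A \<in># snd S" | x A where "Ex x A \<in># fst S"
  proof (cases "\<forall>A\<in>formulas_seq S. qfree A")
    case False
    then obtain A where A: "A \<in># fst S \<or> A \<in># snd S" "\<not> qfree A" by (auto simp: formulas_seq_def)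
    from form(2)[OF A(1)] A that show thesis by (cases rule: prenex_cases) blast+
  qed
  then consider "\<forall>A\<in>formulas_seq S. qfree A"
    | x A where "All x A \<in># fst S" | x A where "Ex x A \<in># snd S"
    | S' where "witness_step L 0 S S'"
  proof cases
    case (4 x A)
    then obtain \<Gamma> \<Delta> where S: "S = (\<Gamma>, add_mset (All x A) \<Delta>)" by (metis insert_DiffM prod.collapse)
    show thesis by (rule that(4)[of "(\<Gamma>, add_mset (subst (Bv x) (Var (Fv 0)) A) \<Delta>)"])
      (use form(1) 4 in \<open>auto simp: S intro: witness_step.intros\<close>)
  next
    case (5 x A)
    then obtain \<Gamma> \<Delta> where S: "S = (add_mset (Ex x A) \<Gamma>, \<Delta>)" by (metis insert_DiffM prod.collapse)
    show thesis by (rule that(4)[of "(add_mset (subst (Bv x) (Var (Fv 0)) A) \<Gamma>, \<Delta>)"])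
      (use form(1) 5 in \<open>auto simp: S intro: witness_step.intros\<close>)
  qed (use that in auto)
  then show ?case
  proof cases
    case 1
    have "val_fm ?M \<beta> A = pval v A" if "A \<in> formulas_seq S" for A
      using val_qfree[OF e \<beta>] that 1 less.prems prenex by (auto simp: prenex_sequents_def)
    then have "val_seq ?M \<beta> S = pval_seq v S"
      unfolding val_seq_def pval_seq_def
      by (intro arg_cong2[of _ _ _ _ "(-)"] arg_cong[of _ _ sum_mset] image_mset_cong) (auto simp: formulas_seq_def)
    then show ?thesis using qfree[OF less.prems 1] by simp
  next
    case (2 x A)
    then obtain \<Gamma> \<Delta> where S: "S = (add_mset (All x A) \<Gamma>, \<Delta>)" by (metis insert_DiffM prod.collapse)
    have "val_fm ?M (\<beta>(Bv x := m)) A \<le> val_seq ?M \<beta> (\<Gamma>, \<Delta>) - c" if m: "m \<in> univ ?M" for m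
    proof -
      obtain t where t: "lterm L t" "m = e t" using m univ by auto
      let ?S = "(add_mset (subst (Bv x) t A) \<Gamma>, \<Delta>)"
      have "?S \<in> X" using inst[OF less.prems] form(1)[of "All x A"] t(1) by (auto simp: S intro: instance_step.intros)
      moreover have "?q ?S < ?q S" by (simp add: S)
      ultimately have "c \<le> val_seq ?M \<beta> ?S" using less.IH by blast
      then show ?thesis using val_inst[OF t(1)] t(2) by (simp add: val_seq_def)
    qed
    then have "val_fm ?M \<beta> (All x A) \<le> val_seq ?M \<beta> (\<Gamma>, \<Delta>) - c"
      using \<open>univ ?M \<noteq> {}\<close> by (auto intro!: cSUP_least)
    then show ?thesis by (simp add: S val_seq_def)
  next
    case (3 x A)
    then obtain \<Gamma> \<Delta> where S: "S = (\<Gamma>, add_mset (Ex x A) \<Delta>)" by (metis insert_DiffM prod.collapse)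
    have "c - val_seq ?M \<beta> (\<Gamma>, \<Delta>) \<le> val_fm ?M (\<beta>(Bv x := m)) A" if m: "m \<in> univ ?M" for m
    proof -
      obtain t where t: "lterm L t" "m = e t" using m univ by auto
      let ?S = "(\<Gamma>, add_mset (subst (Bv x) t A) \<Delta>)"
      have "?S \<in> X" using inst[OF less.prems] form(1)[of "Ex x A"] t(1) by (auto simp: S intro: instance_step.intros)
      moreover have "?q ?S < ?q S" by (simp add: S)
      ultimately have "c \<le> val_seq ?M \<beta> ?S" using less.IH by blast
      then show ?thesis using val_inst[OF t(1)] t(2) by (simp add: val_seq_def)
    qed
    then have "c - val_seq ?M \<beta> (\<Gamma>, \<Delta>) \<le> val_fm ?M \<beta> (Ex x A)"
      using \<open>univ ?M \<noteq> {}\<close> by (auto intro!: cINF_greatest)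
    then show ?thesis by (simp add: S val_seq_def)
  next
    case (4 S0)
    then obtain b S' where S': "S' \<in> X" "witness_step L b S S'" using wit[OF less.prems] by blast
    have "e (Var (Fv b)) \<in> univ ?M" by (auto simp: univ intro: lterm.intros)
    then have sup: "val_fm ?M \<beta> (subst (Bv x) (Var (Fv b)) A) \<le> val_fm ?M \<beta> (All x A)"
      and inf: "val_fm ?M \<beta> (Ex x A) \<le> val_fm ?M \<beta> (subst (Bv x) (Var (Fv b)) A)" for x A
      using bdd[of x A] by (auto simp: val_inst lterm.intros intro!: cSUP_upper cINF_lower)
    have "?q S' < ?q S" using S'(2) by cases auto
    then have "c \<le> val_seq ?M \<beta> S'" using less.IH S'(1) by blast
    also have "\<dots> \<le> val_seq ?M \<beta> S"
      using S'(2) sup inf by cases (auto simp: val_seq_def simp del: val_fm.simps)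
    finally show ?thesis .
  qed
qed

section \<open>Renaming free variables\<close>

abbreviation rename_tm :: "(nat \<Rightarrow> nat) \<Rightarrow> 'f tm \<Rightarrow> 'f tm" where
  "rename_tm f \<equiv> psubst_tm (\<lambda>a. Var (Fv (f a)))"

abbreviation rename :: "(nat \<Rightarrow> nat) \<Rightarrow> ('f, 'p) fm \<Rightarrow> ('f, 'p) fm" where
  "rename f \<equiv> psubst (\<lambda>a. Var (Fv (f a)))"

definition rename_seq :: "(nat \<Rightarrow> nat) \<Rightarrow> ('f, 'p) sequent \<Rightarrow> ('f, 'p) sequent" where
  "rename_seq f S = (image_mset (rename f) (fst S), image_mset (rename f) (snd S))"

abbreviation rename_hs :: "(nat \<Rightarrow> nat) \<Rightarrow> ('f, 'p) hypersequent \<Rightarrow> ('f, 'p) hypersequent" where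
  "rename_hs f \<equiv> image_mset (rename_seq f)"

lemma rename_tm_inverse:
  "(\<And>a. Fv a \<in> vars_tm t \<Longrightarrow> g (f a) = a) \<Longrightarrow> rename_tm g (rename_tm f t) = t"
proof (induction t)
  case (Var v) then show ?case by (cases v) auto
next
  case (Fn h ts)
  have "rename_tm g (rename_tm f t) = t" if "t \<in> set ts" for t
    by (rule Fn.IH[OF that]) (use Fn.prems that in auto)
  then show ?case by (auto intro: map_idI)
qed

lemma rename_inverse:
  "(\<And>a. Fv a \<in> vars_fm A \<Longrightarrow> g (f a) = a) \<Longrightarrow> rename g (rename f A) = A"
proof (induction A)
  case (Pred P ts)
  have "rename_tm g (rename_tm f t) = t" if "t \<in> set ts" for t
    by (rule rename_tm_inverse) (use Pred that in auto)
  then show ?case by (auto intro: map_idI)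
qed auto

lemma vars_rename_tm: "Fv b \<in> vars_tm (rename_tm f t) \<longleftrightarrow> (\<exists>a. b = f a \<and> Fv a \<in> vars_tm t)"
proof (induction t)
  case (Var v) then show ?case by (cases v) auto
qed auto

lemma vars_rename: "Fv b \<in> vars_fm (rename f A) \<longleftrightarrow> (\<exists>a. b = f a \<and> Fv a \<in> vars_fm A)"
  by (induction A) (auto simp: vars_rename_tm)

lemma rename_subst: "rename f (subst (Bv x) t A) = subst (Bv x) (rename_tm f t) (rename f A)"
proof -
  have "rename_tm f (subst_tm (Bv x) t s) = subst_tm (Bv x) (rename_tm f t) (rename_tm f s)" for s
  proof (induction s)
    case (Var v) then show ?case by (cases v) auto
  qed auto
  then show ?thesis by (induction A) auto
qed

lemma formula_rename: "formula L A \<Longrightarrow> formula L (rename f A)"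
  by (rule formula_psubst) (auto intro: lterm.intros)

lemma lterm_rename: "lterm L t \<Longrightarrow> lterm L (rename_tm f t)"
  by (rule lterm_psubst) (auto intro: lterm.intros)

lemma qfree_psubst [simp]: "qfree (psubst \<sigma> A) = qfree A"
  by (induction A) auto

lemma prenex_psubst: "prenex A \<Longrightarrow> prenex (psubst \<sigma> A)"
  by (induction rule: prenex.induct) (auto intro: prenex.intros)

lemma formulas_rename_seq: "formulas_seq (rename_seq f S) = rename f ` formulas_seq S"
  by (auto simp: formulas_seq_def rename_seq_def)

lemma image_mset_repeat: "image_mset h (repeat_mset n M) = repeat_mset n (image_mset h M)"
  by (induction M) (auto simp: repeat_mset_distrib_add_mset)

lemma rename_approx: "rename_seq f (approx_seq n S) = approx_seq n (rename_seq f S)"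
  by (simp add: rename_seq_def approx_seq_def image_mset_repeat)

lemma rename_seq_pair: "rename_seq f (\<Gamma>, \<Delta>) = (image_mset (rename f) \<Gamma>, image_mset (rename f) \<Delta>)"
  by (simp add: rename_seq_def)

lemma GL_rename: "GL L H \<Longrightarrow> GL L (rename_hs f H)"
proof (induction rule: GL.induct)
  case (EW G S)
  then show ?case by (auto simp: formulas_rename_seq formula_rename intro!: GL.EW)
qed (auto simp: rename_seq_pair formula_rename intro: GL.intros)

lemma vars_rename_hs: 
  assumes "inj f" "Fv a \<notin> vars_hs H" shows "Fv (f a) \<notin> vars_hs (rename_hs f H)"
  using assms by (auto simp: vars_hs_def formulas_hs_def formulas_rename_seq vars_rename dest: injD)

text \<open>Every rule commutes with renaming; injectivity is what keeps an eigenvariable away from the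
variables of the conclusion.\<close>
lemma quant_derivable_rename:
  assumes "inj f"
  shows "quant_derivable L n H H' \<Longrightarrow> quant_derivable L n (rename_hs f H) (rename_hs f H')"
proof (induction rule: quant_derivable.induct)
  case start
  show ?case by (rule quant_derivable.start)
next
  case (EW G S)
  then show ?case by (auto simp: formulas_rename_seq formula_rename intro!: quant_derivable.EW)
next
  case (EC S G)
  then show ?case by (auto intro: quant_derivable.EC)
next
  case (All_left x t A \<Gamma> \<Delta> G)
  then show ?case
    using formula_rename[of L "All x A" f] lterm_rename[of L t f]
    by (auto simp: rename_approx rename_seq_pair rename_subst intro: quant_derivable.All_left)
next
  case (All_right \<Gamma> x a A \<Delta> G)
  then show ?case
    using formula_rename[of L "All x A" f] vars_rename_hs[OF assms All_right.hyps(2)]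
    by (auto simp: rename_approx rename_seq_pair rename_subst intro: quant_derivable.All_right)
next
  case (Ex_left x a A \<Gamma> \<Delta> G)
  then show ?case
    using formula_rename[of L "Ex x A" f] vars_rename_hs[OF assms Ex_left.hyps(2)]
    by (auto simp: rename_approx rename_seq_pair rename_subst intro: quant_derivable.Ex_left)
next
  case (Ex_right \<Gamma> x t A \<Delta> G)
  then show ?case
    using formula_rename[of L "Ex x A" f] lterm_rename[of L t f]
    by (auto simp: rename_approx rename_seq_pair rename_subst intro: quant_derivable.Ex_right)
qed

lemma provable_rename:
  assumes "inj f" "provable L n H" shows "provable L n (rename_hs f H)"
proof -
  have "approx_hs n (rename_hs f H) = rename_hs f (approx_hs n H)"
    by (simp add: approx_hs_def rename_approx multiset.map_comp comp_def)
  moreover obtain H0 where "GL L H0" "quant_derivable L n H0 (approx_hs n H)"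
    using assms(2) unfolding provable_def by blast
  ultimately show ?thesis
    unfolding provable_def using GL_rename quant_derivable_rename[OF assms(1)] by metis
qed

definition rename_assign :: "(nat \<Rightarrow> nat) \<Rightarrow> (var \<Rightarrow> 'm) \<Rightarrow> var \<Rightarrow> 'm" where
  "rename_assign f \<beta> w = (case w of Fv a \<Rightarrow> \<beta> (Fv (f a)) | Bv x \<Rightarrow> \<beta> (Bv x))"

lemma val_tm_rename: "val_tm M \<beta> (rename_tm f t) = val_tm M (rename_assign f \<beta>) t"
proof (induction t)
  case (Var v) then show ?case by (cases v) (auto simp: rename_assign_def)
qed (simp add: comp_def cong: map_cong)

lemma val_fm_rename: "val_fm M \<beta> (rename f A) = val_fm M (rename_assign f \<beta>) A"
proof -
  have upd: "rename_assign f (\<beta>(Bv x := m)) = (rename_assign f \<beta>)(Bv x := m)" for \<beta> :: "var \<Rightarrow> 'c" and x m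
    by (auto simp: rename_assign_def fun_eq_iff split: var.splits)
  show ?thesis by (induction A arbitrary: \<beta>) (simp_all add: val_tm_rename upd comp_def)
qed

lemma val_seq_rename: "val_seq M \<beta> (rename_seq f S) = val_seq M (rename_assign f \<beta>) S"
  by (simp add: val_seq_def rename_seq_def val_fm_rename multiset.map_comp comp_def)

section \<open>Model existence\<close>

text \<open>Doubling is undone on the finitely many variables of a given hypersequent by an injective map:
halve the even numbers below \<open>2 K\<close>, and shift all others out of the way by \<open>K\<close>.\<close>
lemma consistent_rename_even:
  assumes "consistent L n X"
  shows "consistent L n (rename_seq (\<lambda>a. 2 * a) ` X)"
  unfolding consistent_def
proof (intro allI impI notI)
  fix H assume H: "set_mset H \<subseteq> rename_seq (\<lambda>a. 2 * a) ` X" "provable L n H"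
  define V where "V = (\<Union>A\<in>formulas_hs H. Fv -` vars_fm A)"
  have "finite V"
    unfolding V_def by (intro finite_UN_I finite_vimageI) (auto simp: inj_def formulas_hs_def formulas_seq_def)
  then obtain K where K: "\<And>a. a \<in> V \<Longrightarrow> a < K"
    unfolding finite_nat_set_iff_bounded by blast
  define g where "g j = (if even j \<and> j < 2 * K then j div 2 else j + K)" for j
  have "inj g"
  proof (rule injI)
    fix i j assume eq: "g i = g j"
    have small: "k = 2 * g k \<and> g k < K" if "even k \<and> k < 2 * K" for k
      using that by (auto simp: g_def)
    have large: "g k = k + K" if "\<not> (even k \<and> k < 2 * K)" for k
      using that by (simp only: g_def if_False)
    show "i = j" using small[of i] small[of j] large[of i] large[of j] eq by linarith
  qed
  then have "provable L n (rename_hs g H)" using H(2) by (rule provable_rename)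
  have "rename_seq g S \<in> X" if S: "S \<in># H" for S
  proof -
    obtain S0 where S0: "S = rename_seq (\<lambda>a. 2 * a) S0" "S0 \<in> X"
      by (rule imageE[OF subsetD[OF H(1) S]])
    have "rename g (rename (\<lambda>a. 2 * a) A) = A" if A: "A \<in> formulas_seq S0" for A
    proof (rule rename_inverse)
      fix a assume "Fv a \<in> vars_fm A"
      then have "Fv (2 * a) \<in> vars_fm (rename (\<lambda>a. 2 * a) A)" by (auto simp: vars_rename)
      moreover have "rename (\<lambda>a. 2 * a) A \<in> formulas_hs H"
      proof -
        have "formulas_seq S \<subseteq> formulas_hs H" using S by (auto simp: formulas_hs_def)
        moreover have "rename (\<lambda>a. 2 * a) A \<in> formulas_seq S" using A by (simp add: S0(1) formulas_rename_seq)
        ultimately show ?thesis by (rule subsetD)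
      qed
      ultimately have "2 * a < K" using K[of "2 * a"] unfolding V_def by blast
      then show "g (2 * a) = a" by (simp add: g_def)
    qed
    then have "rename_seq g S = S0"
      by (cases S0) (auto simp: S0(1) rename_seq_def formulas_seq_def multiset.map_comp comp_def
          intro!: multiset.map_ident_strong)
    then show ?thesis using S0(2) by simp
  qed
  then have "set_mset (rename_hs g H) \<subseteq> X" unfolding set_image_mset by (rule image_subsetI)
  then show False
    using assms \<open>provable L n (rename_hs g H)\<close> unfolding consistent_def by simp
qed

text \<open>The odd variables are free for use as witnesses after renaming; the model found for the renamed
sequents serves the original ones under the renamed assignment.\<close>
theorem model_existence:
  fixes L :: "('f, 'p) lang"
  assumes L: "countable_lang L" and X: "consistent L n X" "X \<subseteq> prenex_sequents L"
    and inf: "infinite (UNIV :: 'm set)" and n: "n > 0"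
  shows "\<exists>(M :: ('f, 'p, 'm) struct) \<beta>. is_interpretation L M \<beta> \<and> (\<forall>S\<in>X. 1 / n \<le> val_seq M \<beta> S)"
proof -
  let ?X = "rename_seq (\<lambda>a. 2 * a) ` X"
  have "?X \<subseteq> prenex_sequents L"
  proof (rule image_subsetI)
    fix S assume "S \<in> X"
    then have "\<forall>A\<in>formulas_seq S. formula L A \<and> prenex A" using X(2) by (auto simp: prenex_sequents_def)
    then show "rename_seq (\<lambda>a. 2 * a) S \<in> prenex_sequents L"
      by (auto simp: prenex_sequents_def formulas_rename_seq formula_rename prenex_psubst)
  qed
  moreover have "infinite (fresh_vars ?X)"
  proof -
    have "range (\<lambda>k. 2 * k + 1) \<subseteq> fresh_vars ?X"
      by (auto simp: fresh_vars_def formulas_rename_seq vars_rename) presburger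
    moreover have "infinite (range (\<lambda>k::nat. 2 * k + 1))"
      by (rule range_inj_infinite) (auto simp: inj_def)
    ultimately show ?thesis using infinite_super by blast
  qed
  ultimately have "\<exists>Y. ?X \<subseteq> Y \<and> Y \<subseteq> prenex_sequents L \<and> consistent L n Y \<and>
      (\<forall>S\<in>Y. \<forall>S'. instance_step L S S' \<longrightarrow> S' \<in> Y) \<and>
      (\<forall>S\<in>Y. \<forall>a S'. witness_step L a S S' \<longrightarrow> (\<exists>b. \<exists>S''\<in>Y. witness_step L b S S''))"
    by (rule henkin_extension[OF L consistent_rename_even[OF X(1)]])
  then obtain Y where Y: "?X \<subseteq> Y" "Y \<subseteq> prenex_sequents L" "consistent L n Y"
    and inst: "\<forall>S\<in>Y. \<forall>S'. instance_step L S S' \<longrightarrow> S' \<in> Y"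
    and wit: "\<forall>S\<in>Y. \<forall>a S'. witness_step L a S S' \<longrightarrow> (\<exists>b. \<exists>S''\<in>Y. witness_step L b S S'')"
    by (elim exE conjE)
  have "\<exists>v. unit_valuation v \<and> (\<forall>S\<in>{S\<in>Y. \<forall>A\<in>formulas_seq S. qfree A}. 1 / n \<le> pval_seq v S)"
  proof (rule valuation_compactness)
    fix F assume F: "finite F" "F \<subseteq> {S\<in>Y. \<forall>A\<in>formulas_seq S. qfree A}"
    let ?H = "approx_hs n (mset_set F)"
    have "set_mset (mset_set F) \<subseteq> Y" using F by auto
    then have "\<not> provable L n (mset_set F)" using Y(3) by (simp add: consistent_def)
    then have "\<not> GL L ?H" by (auto simp: provable_def intro: quant_derivable.start)
    moreover have "formula L A \<and> qfree A" if "A \<in> formulas_hs ?H" for A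
    proof -
      from that obtain S where S: "S \<in> F" "A \<in> formulas_seq (approx_seq n S)"
        using F(1) by (auto simp: formulas_hs_def approx_hs_def)
      then have "A = Bot \<or> A \<in> formulas_seq S" using formulas_approx by blast
      then show ?thesis using S(1) F(2) Y(2) by (auto simp: prenex_sequents_def intro: formula.intros)
    qed
    \<comment> \<open>A hypersequent that \<open>GL\<close> does not derive has a countermodel.\<close>
    ultimately obtain v where v: "unit_valuation v" "\<And>S. S \<in># ?H \<Longrightarrow> 0 < pval_seq v S"
      using GL_complete[of L ?H] by (force simp: lang_hs_def propositional_hs_def)
    have "1 / n \<le> pval_seq v S" if "S \<in> F" for S
    proof -
      have rep: "(\<Sum>A\<in>#repeat_mset n M. pval v A) = n * (\<Sum>A\<in>#M. pval v A)" for M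
        by (induction M) (auto simp: repeat_mset_distrib_add_mset algebra_simps)
      have "0 < pval_seq v (approx_seq n S)" using v(2) that F(1) by (simp add: approx_hs_def)
      also have "\<dots> = n * pval_seq v S - 1"
        by (simp add: pval_seq_def approx_seq_def rep algebra_simps)
      finally show ?thesis using n by (simp add: field_simps)
    qed
    then show "\<exists>v. unit_valuation v \<and> (\<forall>S\<in>F. 1 / n \<le> pval_seq v S)" using v(1) by blast
  qed
  then obtain v where v: "unit_valuation v"
    "\<And>S. S \<in> Y \<Longrightarrow> \<forall>A\<in>formulas_seq S. qfree A \<Longrightarrow> 1 / n \<le> pval_seq v S" by blast
  have "countable {t. lterm L t}" using L by (intro countable_lterms) (simp add: countable_lang_def)
  moreover obtain h :: "nat \<Rightarrow> 'm" where "inj h" using infinite_countable_subset[OF inf] by blast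
  ultimately have e: "inj_on (h \<circ> to_nat_on {t. lterm L t}) {t. lterm L t}"
    by (intro comp_inj_on inj_on_to_nat_on) (auto intro: inj_on_subset)
  let ?e = "h \<circ> to_nat_on {t. lterm L t}"
  let ?M = "term_struct L ?e v"
  define \<beta> where "\<beta> w = ?e (Var (Fv (case w of Fv a \<Rightarrow> a | Bv x \<Rightarrow> 0)))" for w
  have "1 / n \<le> val_seq ?M \<beta> S" if "S \<in> Y" for S
  proof (rule truth_lemma[OF e v(1) _ Y(2) _ _ v(2) that])
    show "\<exists>b. \<exists>S''\<in>Y. witness_step L b S S''" if "S \<in> Y" "witness_step L a S S'" for S S' a
      using wit that by blast
  qed (use inst in \<open>auto simp: \<beta>_def\<close>)
  then have "\<forall>S\<in>X. 1 / n \<le> val_seq ?M (rename_assign (\<lambda>a. 2 * a) \<beta>) S"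
    using Y(1) by (simp add: image_subset_iff flip: val_seq_rename)
  moreover have "is_interpretation L ?M (rename_assign (\<lambda>a. 2 * a) \<beta>)"
    by (rule interpretation_term_struct[OF e v(1)])
      (auto simp: rename_assign_def \<beta>_def intro: lterm.intros split: var.split)
  ultimately show ?thesis by blast
qed

theorem theorem4p2:
  fixes L :: "('f, 'p) lang"
    and T :: "('f, 'p) fm set"
    and G :: "('f, 'p) hypersequent"
    and n :: nat
  assumes "countable_lang L"
    and "lang_theory L T" and "\<forall>A\<in>T. prenex A"
    and "lang_hs L G" and "prenex_hs G"
    and "infinite (UNIV :: 'm set)"
    and "entails TYPE('m) L T G"
    and "n > 0"
  shows "\<exists>Gn :: ('f, 'p) hypersequent.
           lang_hs L Gn \<and> propositional_hs Gn \<and>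
           GL L Gn \<and>
           (\<exists>(k::nat) (m :: nat \<Rightarrow> nat) (C :: nat \<Rightarrow> ('f, 'p) fm).
              (\<forall>i\<in>{1..k}. m i > 0 \<and> C i \<in> T) \<and>
              quant_derivable L n Gn
                (image_mset (\<lambda>i. approx_seq n (replicate_mset (m i) (C i), {#Bot#})) (mset_set {1..k})
                 + approx_hs n G))"
proof -
  define Ax :: "('f, 'p) sequent set" where "Ax = {(replicate_mset m C, {#Bot#}) | m C. m > 0 \<and> C \<in> T}"
  have prenex: "set_mset G \<union> Ax \<subseteq> prenex_sequents L"
    using assms(2-5) unfolding Ax_def
    by (auto simp: prenex_sequents_def formulas_seq_def formulas_hs_def lang_theory_def lang_hs_def
        prenex_hs_def intro: formula.intros prenex.intros)
  \<comment> \<open>Otherwise there is a model of \<open>T\<close> in which \<open>G\<close> has value at least \<open>1/n\<close>.\<close>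
  have "\<not> consistent L n (set_mset G \<union> Ax)"
  proof
    assume "consistent L n (set_mset G \<union> Ax)"
    from model_existence[OF assms(1) this prenex assms(6,8)]
    obtain M :: "('f, 'p, 'm) struct" and \<beta> where M: "is_interpretation L M \<beta>"
      "\<And>S. S \<in> set_mset G \<union> Ax \<Longrightarrow> 1 / n \<le> val_seq M \<beta> S" by blast
    have pos: "0 < 1 / real n" using assms(8) by simp
    have "val_fm M \<beta> C \<le> 0" if "C \<in> T" for C
    proof (rule ccontr)
      assume "\<not> val_fm M \<beta> C \<le> 0"
      then obtain m where m: "1 < real m * val_fm M \<beta> C" using reals_Archimedean3 by (meson not_le)
      then have "m > 0" by (cases m) auto
      then have "(replicate_mset m C, {#Bot#}) \<in> Ax" using that by (auto simp: Ax_def)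
      with M(2) have "1 / n \<le> val_seq M \<beta> (replicate_mset m C, {#Bot#})" by blast
      then show False using m pos by (simp add: val_seq_def)
    qed
    then have "is_model L T M \<beta>"
      using M(1) by (auto simp: is_model_def true_hs_def val_hs_def val_seq_def)
    then have "val_hs M \<beta> G \<le> 0" using assms(7) by (auto simp: entails_def true_hs_def)
    moreover have "ereal (1 / n) \<le> val_hs M \<beta> G"
      unfolding val_hs_def by (rule INF_greatest) (use M(2) in auto)
    ultimately have "ereal (1 / n) \<le> 0" by (rule order_trans[rotated])
    then show False using pos by simp
  qed
  then obtain H where H: "set_mset H \<subseteq> set_mset G \<union> Ax" "provable L n H" by (auto simp: consistent_def)
  \<comment> \<open>Of the sequents from \<open>G\<close>, an inconsistency may use some and repeat others; restore them to \<open>G\<close>.\<close>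
  obtain xs where xs: "mset xs = filter_mset (\<lambda>S. S \<in> Ax) H" using ex_mset by blast
  have "lang_hs L (mset xs + G)"
    using prenex xs H(1) by (auto simp: lang_hs_def formulas_hs_def prenex_sequents_def)
  moreover have "set_mset H \<subseteq> set_mset (mset xs + G)" using H(1) xs by auto
  ultimately have "provable L n (mset xs + G)" using provable_mono[OF H(2)] by blast
  then obtain Gn where Gn: "GL L Gn" "quant_derivable L n Gn (approx_hs n (mset xs + G))"
    by (auto simp: provable_def)
  have "\<exists>m C. m > 0 \<and> C \<in> T \<and> xs ! i = (replicate_mset m C, {#Bot#})" if "i < length xs" for i
  proof -
    have "xs ! i \<in># mset xs" using that by simp
    then have "xs ! i \<in> Ax" unfolding xs by simp
    then show ?thesis by (auto simp: Ax_def)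
  qed
  then obtain m C where mC:
    "\<And>i. i < length xs \<Longrightarrow> m i > 0 \<and> C i \<in> T \<and> xs ! i = (replicate_mset (m i) (C i), {#Bot#})"
    by metis
  let ?k = "length xs"
  have "mset_set {1..?k} = image_mset Suc (mset [0..<?k])"
    by (simp add: image_mset_mset_set image_Suc_atLeastLessThan atLeastLessThanSuc_atLeastAtMost)
  then have "image_mset (\<lambda>i. approx_seq n (replicate_mset (m (i - 1)) (C (i - 1)), {#Bot#})) (mset_set {1..?k}) =
      image_mset (\<lambda>i. approx_seq n (xs ! i)) (mset [0..<?k])"
    by (auto simp: multiset.map_comp mC intro!: image_mset_cong simp del: mset_upt)
  also have "\<dots> = approx_hs n (mset (map ((!) xs) [0..<?k]))"
    by (simp add: approx_hs_def multiset.map_comp comp_def)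
  finally have "image_mset (\<lambda>i. approx_seq n (replicate_mset (m (i - 1)) (C (i - 1)), {#Bot#})) (mset_set {1..?k}) =
      approx_hs n (mset xs)" by (simp add: map_nth)
  with Gn(2) have "quant_derivable L n Gn
      (image_mset (\<lambda>i. approx_seq n (replicate_mset (m (i - 1)) (C (i - 1)), {#Bot#})) (mset_set {1..?k})
        + approx_hs n G)" by simp
  moreover have "\<forall>i\<in>{1..?k}. m (i - 1) > 0 \<and> C (i - 1) \<in> T" using mC by auto
  ultimately show ?thesis
    using Gn(1) GL_language[OF Gn(1)]
    by (intro exI[of _ Gn] exI[of _ ?k] exI[of _ "\<lambda>i. m (i - 1)"] exI[of _ "\<lambda>i. C (i - 1)"] conjI) simp_all
qed

end
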